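(* If $X \subseteq \omega$ is $2$-random, then $\mathcal E(X) \leq_{\mathrm{nc}} \mathcal I(X)$ but $\mathcal E(X) \not\leq_{\mathrm{uc}} \mathcal I(X)$.
   Context: For $A \subseteq \omega$ and $n \geq 1$ let $\rho_n(A) = |A \cap [0,n)|/n$; the density $\rho(A)$ is $\lim_n \rho_n(A)$ when it exists. $D$ is a coarse description of $X$ if $\rho(D \triangle X) = 0$. $Y \leq_{\mathrm{uc}} X$ if there is a Turing functional $\Phi$ such that for every coarse description $D$ of $X$, $\Phi^D$ is a coarse description of $Y$. $Y \leq_{\mathrm{nc}} X$ if every coarse description of $X$ computes a coarse description of $Y$. Let $I_n = [n!,(n+1)!)$, $\mathcal I(A) = \bigcup_{n \in A} I_n$, $\mathcal H(A) = \{\langle n,i\rangle : n \in A,\ i \in \omega\}$ (with $\langle\cdot,\cdot\rangle$ a computable pairing function), and $\mathcal E(A) = \mathcal I(\mathcal H(A))$. A set is $2$-random if it is Martin-Löf random relative to $\emptyset'$. *)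

theory Defs
  imports "HOL-Probability.Probability" "HOL-Library.Nat_Bijection"
begin

section \<open>Computability relative to an oracle\<close>

text \<open>
  Turing functionals are presented by programs for the partial recursive functions with an
  oracle: one program denotes a partial function for every oracle and every number of arguments.
\<close>

datatype prog =
    Zero
  | Succ
  | Proj nat
  | Oracle
  | Comp prog "prog list"
  | PrimRec prog prog
  | Mu prog

text \<open>
  The value \<open>None\<close> means divergence. Composition is strict, also in arguments that are not used,
  and a \<open>Mu\<close>-search diverges if the searched function diverges before its first zero.
  Programs applied to too few arguments diverge.
\<close>

primrec eval :: "nat set \<Rightarrow> prog \<Rightarrow> nat list \<Rightarrow> nat option" where
  "eval A Zero = (\<lambda>xs. Some 0)"
| "eval A Succ = (\<lambda>xs. case xs of [] \<Rightarrow> None | x # _ \<Rightarrow> Some (Suc x))"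
| "eval A (Proj i) = (\<lambda>xs. if i < length xs then Some (xs ! i) else None)"
| "eval A Oracle = (\<lambda>xs. case xs of [] \<Rightarrow> None | x # _ \<Rightarrow> Some (of_bool (x \<in> A)))"
| "eval A (Comp p qs) = (\<lambda>xs.
     let ys = map (\<lambda>f. f xs) (map (eval A) qs)
     in if None \<in> set ys then None else eval A p (map the ys))"
| "eval A (PrimRec p q) = (\<lambda>xs. case xs of
       [] \<Rightarrow> None
     | n # zs \<Rightarrow>
         rec_nat (eval A p zs) (\<lambda>k r. Option.bind r (\<lambda>y. eval A q (k # y # zs))) n)"
| "eval A (Mu p) = (\<lambda>xs.
     if \<exists>n. eval A p (n # xs) = Some 0 \<and> (\<forall>m<n. eval A p (m # xs) \<noteq> None)
     then Some (LEAST n. eval A p (n # xs) = Some 0)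
     else None)"

text \<open>\<open>computes_set p D Z\<close>: the functional \<open>p\<close> with oracle \<open>D\<close> is total on unary inputs, and is the
  characteristic function of \<open>Z\<close>.\<close>

definition computes_set :: "prog \<Rightarrow> nat set \<Rightarrow> nat set \<Rightarrow> bool" where
  "computes_set p D Z \<longleftrightarrow> (\<forall>n. eval D p [n] = Some (of_bool (n \<in> Z)))"

definition computable_pairing :: "(nat \<Rightarrow> nat \<Rightarrow> nat) \<Rightarrow> bool" where
  "computable_pairing pair \<longleftrightarrow>
     bij (\<lambda>(n, i). pair n i) \<and> (\<exists>p. \<forall>n i. eval {} p [n, i] = Some (pair n i))"

primrec prog_code :: "prog \<Rightarrow> nat" where
  "prog_code Zero = prod_encode (0, 0)"
| "prog_code Succ = prod_encode (1, 0)"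
| "prog_code (Proj i) = prod_encode (2, i)"
| "prog_code Oracle = prod_encode (3, 0)"
| "prog_code (Comp p qs) = prod_encode (4, prod_encode (prog_code p, list_encode (map prog_code qs)))"
| "prog_code (PrimRec p q) = prod_encode (5, prod_encode (prog_code p, prog_code q))"
| "prog_code (Mu p) = prod_encode (6, prog_code p)"

lemma inj_prog_code: "inj prog_code"
proof (rule injI)
  show "p = q" if "prog_code p = prog_code q" for p q
    using that
  proof (induction p arbitrary: q)
    case (Comp p ps)
    then obtain p' ps' where q: "q = Comp p' ps'"
      by (cases q) (auto simp: prod_encode_eq)
    with Comp.prems have "prog_code p = prog_code p'" and *: "map prog_code ps = map prog_code ps'"
      by (auto simp: prod_encode_eq list_encode_eq)
    moreover have "ps = ps'"
    proof (rule nth_equalityI)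
      show len: "length ps = length ps'"
        using * by (rule map_eq_imp_length_eq)
      show "ps ! i = ps' ! i" if "i < length ps" for i
        using Comp.IH(2)[of "ps ! i" "ps' ! i"] that len arg_cong[OF *, of "\<lambda>l. l ! i"] by simp
    qed
    ultimately show ?case
      using Comp.IH(1) q by blast
  next
    case Zero then show ?case by (cases q) (auto simp: prod_encode_eq)
  next
    case Succ then show ?case by (cases q) (auto simp: prod_encode_eq)
  next
    case (Proj i) then show ?case by (cases q) (auto simp: prod_encode_eq)
  next
    case Oracle then show ?case by (cases q) (auto simp: prod_encode_eq)
  next
    case (PrimRec p1 p2) then show ?case by (cases q) (auto simp: prod_encode_eq)
  next
    case (Mu p) then show ?case by (cases q) (auto simp: prod_encode_eq)
  qed
qed

definition turing_jump :: "nat set \<Rightarrow> nat set" where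
  "turing_jump A = {prog_code p | p. eval A p [prog_code p] \<noteq> None}"


section \<open>Martin-Loef randomness\<close>

text \<open>The fair-coin measure on Cantor space; a set \<open>X\<close> corresponds to the sequence
  \<open>\<lambda>i. i \<in> X\<close>.\<close>

definition cantor_measure :: "(nat \<Rightarrow> bool) measure" where
  "cantor_measure = PiM UNIV (\<lambda>_. measure_pmf (bernoulli_pmf (1 / 2)))"

definition cylinder :: "bool list \<Rightarrow> (nat \<Rightarrow> bool) set" where
  "cylinder \<sigma> = {x. \<forall>i<length \<sigma>. x i = \<sigma> ! i}"

definition string_code :: "bool list \<Rightarrow> nat" where
  "string_code \<sigma> = list_encode (map of_bool \<sigma>)"

text \<open>The classes \<open>effective_open A p n\<close>, for \<open>n = 0, 1, 2, \<dots>\<close>, are the uniform sequence of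
  \<open>\<Sigma>\<^sup>0\<^sub>1(A)\<close> classes generated by the \<open>A\<close>-c.e. sets of strings given by the domain of \<open>p\<close>.\<close>

definition effective_open :: "nat set \<Rightarrow> prog \<Rightarrow> nat \<Rightarrow> (nat \<Rightarrow> bool) set" where
  "effective_open A p n = (\<Union>\<sigma>\<in>{\<sigma>. eval A p [n, string_code \<sigma>] \<noteq> None}. cylinder \<sigma>)"

definition martin_loef_test :: "nat set \<Rightarrow> (nat \<Rightarrow> (nat \<Rightarrow> bool) set) \<Rightarrow> bool" where
  "martin_loef_test A U \<longleftrightarrow>
     (\<exists>p. U = effective_open A p) \<and> (\<forall>n. measure cantor_measure (U n) \<le> (1 / 2) ^ n)"

definition martin_loef_random :: "nat set \<Rightarrow> nat set \<Rightarrow> bool" where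
  "martin_loef_random A X \<longleftrightarrow> (\<forall>U. martin_loef_test A U \<longrightarrow> (\<lambda>i. i \<in> X) \<notin> (\<Inter>n. U n))"

definition two_random :: "nat set \<Rightarrow> bool" where
  "two_random X \<longleftrightarrow> martin_loef_random (turing_jump {}) X"


section \<open>Coarse descriptions and coarse reducibilities\<close>

definition partial_density :: "nat \<Rightarrow> nat set \<Rightarrow> real" where
  "partial_density n A = real (card (A \<inter> {0..<n})) / real n"

definition has_density :: "nat set \<Rightarrow> real \<Rightarrow> bool" where
  "has_density A d \<longleftrightarrow> (\<lambda>n. partial_density n A) \<longlonglongrightarrow> d"

definition coarse_description :: "nat set \<Rightarrow> nat set \<Rightarrow> bool" where
  "coarse_description D X \<longleftrightarrow> has_density (sym_diff D X) 0"

definition uc_reducible :: "nat set \<Rightarrow> nat set \<Rightarrow> bool"  (infix "\<le>\<^sub>u\<^sub>c" 50) where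
  "Y \<le>\<^sub>u\<^sub>c X \<longleftrightarrow>
     (\<exists>p. \<forall>D. coarse_description D X \<longrightarrow> (\<exists>Z. computes_set p D Z \<and> coarse_description Z Y))"

definition nc_reducible :: "nat set \<Rightarrow> nat set \<Rightarrow> bool"  (infix "\<le>\<^sub>n\<^sub>c" 50) where
  "Y \<le>\<^sub>n\<^sub>c X \<longleftrightarrow>
     (\<forall>D. coarse_description D X \<longrightarrow> (\<exists>p Z. computes_set p D Z \<and> coarse_description Z Y))"


section \<open>The coding operators\<close>

definition factorial_interval :: "nat \<Rightarrow> nat set" where
  "factorial_interval n = {fact n..<fact (n + 1)}"

definition \<I> :: "nat set \<Rightarrow> nat set" where
  "\<I> A = (\<Union>n\<in>A. factorial_interval n)"

definition \<H> :: "(nat \<Rightarrow> nat \<Rightarrow> nat) \<Rightarrow> nat set \<Rightarrow> nat set" where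
  "\<H> pair A = {pair n i | n i. n \<in> A}"

definition \<E> :: "(nat \<Rightarrow> nat \<Rightarrow> nat) \<Rightarrow> nat set \<Rightarrow> nat set" where
  "\<E> pair A = \<I> (\<H> pair A)"

end

theory Submission
  imports Defs
begin

text \<open>
  A majority vote on \<open>I\<^sub>n\<close> recovers \<open>X\<close> from a coarse description of \<open>\<I>(X)\<close> up to finitely many
  errors, and \<open>X\<close> computes \<open>\<E>(X)\<close> outright; patching the finitely many errors is the only
  non-uniform step.

  Conversely, let \<open>p\<close> witness a uniform reduction. As \<open>\<I>(X - {n})\<close> is a coarse description of
  \<open>\<I>(X)\<close>, the majority values of \<open>p\<close> with oracle \<open>\<I>(X - {n})\<close> on the intervals coded by
  \<open>pair n i\<close> tend to \<open>X(n)\<close> as \<open>i\<close> grows. So the bit \<open>X(n)\<close> is limit computable from the other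
  bits. For 2-random \<open>X\<close> the jump decides which finite piece of \<open>X\<close> suffices to read off the
  limit, up to a set of small measure, so \<open>X\<close> guesses each of its bits from the others with
  the help of \<open>{}'\<close>. A set that is random relative to \<open>A\<close> cannot do this relative to \<open>A\<close>: each
  guess is right on at most half of the space.
\<close>

section \<open>Functions recursive in an oracle\<close>

text \<open>A limit over the remaining bits of \<open>X\<close> would be decided by the jump of
  those bits, which a test relative to \<open>{}'\<close> does not have. Measure replaces it: a
  wrong candidate for the limit is refuted at a finite stage, and the event of being refuted only
  after stage \<open>m\<close> has probability tending to 0 in \<open>m\<close>. Events of a fixed
  stage are clopen with computable rational probability, so \<open>{}'\<close> can find a good
  \<open>m\<close>. This is the effective core of the fact that the jump of a 2-random
  \<open>X\<close> is computable from \<open>X\<close> and \<open>{}'\<close>.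

  Guesses at different bits are not independent, since the guess at \<open>n\<close> may read bits
  on both sides of \<open>n\<close>. Hence one bit is guessed at a time, and the next lies above all
  that was read. On sets other than \<open>X\<close> a guess may never appear; this only lowers the
  probability of success.

  The factorials make \<open>I_n\<close> fill all but a fraction \<open>1/(n+1)\<close> of
  \<open>[0,(n+1)!)\<close>, so small density of the errors forces a correct majority on every late
  interval. Each bit of \<open>X\<close> is coded on an infinite row of intervals, so finitely many
  bad intervals do not change its limit.\<close>

definition recursive_in :: "nat set \<Rightarrow> nat \<Rightarrow> (nat list \<Rightarrow> nat) \<Rightarrow> bool" where
  "recursive_in A n f \<longleftrightarrow> (\<exists>p. \<forall>xs. length xs = n \<longrightarrow> eval A p xs = Some (f xs))"

abbreviation decidable_in :: "nat set \<Rightarrow> nat \<Rightarrow> (nat list \<Rightarrow> bool) \<Rightarrow> bool" where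
  "decidable_in A n P \<equiv> recursive_in A n (\<lambda>xs. of_bool (P xs))"

lemma recursive_in_cong:
  assumes "recursive_in A n f" "\<And>xs. length xs = n \<Longrightarrow> f xs = g xs"
  shows "recursive_in A n g"
  using assms unfolding recursive_in_def by fastforce

lemma eval_Comp_total:
  assumes "\<And>i. i < length qs \<Longrightarrow> eval A (qs ! i) xs = Some (ys ! i)" and "length ys = length qs"
  shows "eval A (Comp p qs) xs = eval A p ys"
proof -
  have "map (\<lambda>f. f xs) (map (eval A) qs) = map Some ys"
    by (rule nth_equalityI) (use assms in auto)
  moreover have "None \<notin> set (map Some ys)"
    by auto
  ultimately show ?thesis
    by (simp only: eval.simps Let_def if_False) (simp add: comp_def)
qed

declare eval.simps(5) [simp del]

named_theorems rec_intros

lemma recursive_in_proj [rec_intros]: "i < n \<Longrightarrow> recursive_in A n (\<lambda>xs. xs ! i)"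
  unfolding recursive_in_def by (rule exI[of _ "Proj i"]) auto

lemma recursive_in_subst:
  assumes g: "recursive_in A m g" and "length fs = m" and "\<And>f. f \<in> set fs \<Longrightarrow> recursive_in A n f"
  shows "recursive_in A n (\<lambda>xs. g (map (\<lambda>f. f xs) fs))"
proof -
  from assms(3) have "\<forall>f\<in>set fs. \<exists>p. \<forall>xs. length xs = n \<longrightarrow> eval A p xs = Some (f xs)"
    unfolding recursive_in_def by blast
  then obtain q where q: "\<And>f xs. f \<in> set fs \<Longrightarrow> length xs = n \<Longrightarrow> eval A (q f) xs = Some (f xs)"
    by metis
  from g obtain p where p: "\<And>xs. length xs = m \<Longrightarrow> eval A p xs = Some (g xs)"
    unfolding recursive_in_def by blast
  have "eval A (Comp p (map q fs)) xs = Some (g (map (\<lambda>f. f xs) fs))" if "length xs = n" for xs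
    by (subst eval_Comp_total[where ys = "map (\<lambda>f. f xs) fs"]) (use q p that assms(2) in auto)
  then show ?thesis unfolding recursive_in_def by blast
qed

lemma recursive_in_subst1:
  "recursive_in A 1 (\<lambda>xs. g (xs ! 0)) \<Longrightarrow> recursive_in A n f \<Longrightarrow> recursive_in A n (\<lambda>xs. g (f xs))"
  using recursive_in_subst[of A 1 "\<lambda>xs. g (xs ! 0)" "[f]" n] by simp

lemma recursive_in_subst2:
  assumes "recursive_in A 2 (\<lambda>xs. g (xs ! 0) (xs ! 1))" "recursive_in A n f1" "recursive_in A n f2"
  shows "recursive_in A n (\<lambda>xs. g (f1 xs) (f2 xs))"
  using recursive_in_subst[of A 2 "\<lambda>xs. g (xs ! 0) (xs ! 1)" "[f1, f2]" n] assms by auto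

lemma recursive_in_subst3:
  assumes "recursive_in A 3 (\<lambda>xs. g (xs ! 0) (xs ! 1) (xs ! 2))"
    "recursive_in A n f1" "recursive_in A n f2" "recursive_in A n f3"
  shows "recursive_in A n (\<lambda>xs. g (f1 xs) (f2 xs) (f3 xs))"
  using recursive_in_subst[of A 3 "\<lambda>xs. g (xs ! 0) (xs ! 1) (xs ! 2)" "[f1, f2, f3]" n] assms
  by (auto simp: numeral_2_eq_2)

lemma recursive_in_subst4:
  assumes "recursive_in A 4 (\<lambda>xs. g (xs ! 0) (xs ! 1) (xs ! 2) (xs ! 3))"
    "recursive_in A n f1" "recursive_in A n f2" "recursive_in A n f3" "recursive_in A n f4"
  shows "recursive_in A n (\<lambda>xs. g (f1 xs) (f2 xs) (f3 xs) (f4 xs))"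
  using recursive_in_subst[of A 4 "\<lambda>xs. g (xs ! 0) (xs ! 1) (xs ! 2) (xs ! 3)" "[f1, f2, f3, f4]" n] assms
  by (auto simp: numeral_2_eq_2 numeral_3_eq_3)

text \<open>Recursion, sums, bounded quantifiers and searches put their bound variable in front of
  the argument list. The parameters of a body therefore appear as \<open>tl\<close> of its
  arguments, or \<open>tl (tl _)\<close> under two binders.\<close>

lemma recursive_in_tl:
  assumes "recursive_in A n f"
  shows "recursive_in A (Suc n) (\<lambda>xs. f (tl xs))"
proof (rule recursive_in_cong)
  show "recursive_in A (Suc n) (\<lambda>xs. f (map (\<lambda>g. g xs) (map (\<lambda>i xs. xs ! Suc i) [0..<n])))"
    by (rule recursive_in_subst[OF assms]) (auto intro!: rec_intros)
  show "f (map (\<lambda>g. g xs) (map (\<lambda>i xs. xs ! Suc i) [0..<n])) = f (tl xs)"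
    if "length xs = Suc n" for xs
    by (rule arg_cong[where f = f], rule nth_equalityI) (use that in \<open>auto simp: nth_tl\<close>)
qed

lemma recursive_in_tl2:
  "recursive_in A n f \<Longrightarrow> recursive_in A (Suc (Suc n)) (\<lambda>xs. f (tl (tl xs)))"
  using recursive_in_tl[OF recursive_in_tl] by blast

lemma recursive_in_tl_nth [rec_intros]:
  "Suc i < n \<Longrightarrow> recursive_in A n (\<lambda>xs. tl xs ! i)"
  "Suc (Suc i) < n \<Longrightarrow> recursive_in A n (\<lambda>xs. tl (tl xs) ! i)"
  "Suc (Suc (Suc i)) < n \<Longrightarrow> recursive_in A n (\<lambda>xs. tl (tl (tl xs)) ! i)"
  by (rule recursive_in_cong[OF recursive_in_proj]; auto simp: nth_tl)+

lemma recursive_in_const [rec_intros]: "recursive_in A n (\<lambda>_. c)"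
proof (induction c)
  case 0
  show ?case unfolding recursive_in_def by (rule exI[of _ Zero]) auto
next
  case (Suc c)
  then obtain p where "\<And>xs. length xs = n \<Longrightarrow> eval A p xs = Some c"
    unfolding recursive_in_def by blast
  then have "eval A (Comp Succ [p]) xs = Some (Suc c)" if "length xs = n" for xs
    by (subst eval_Comp_total[where ys = "[c]"]) (use that in auto)
  then show ?case unfolding recursive_in_def by blast
qed

lemma recursive_in_Suc [rec_intros]:
  assumes "recursive_in A n f" shows "recursive_in A n (\<lambda>xs. Suc (f xs))"
proof (rule recursive_in_subst1[OF _ assms])
  show "recursive_in A 1 (\<lambda>xs. Suc (xs ! 0))"
    unfolding recursive_in_def by (rule exI[of _ Succ]) (auto split: list.splits)
qed

lemma decidable_in_oracle [rec_intros]: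
  assumes "recursive_in A n f" shows "decidable_in A n (\<lambda>xs. f xs \<in> A)"
proof -
  have "decidable_in A 1 (\<lambda>xs. xs ! 0 \<in> A)"
    unfolding recursive_in_def by (rule exI[of _ Oracle]) (auto split: list.splits)
  from recursive_in_subst1[OF this assms] show ?thesis .
qed

lemma recursive_in_rec_nat:
  assumes f: "recursive_in A n f" and g: "recursive_in A n g"
    and h: "recursive_in A (Suc (Suc n)) (\<lambda>ys. h (ys ! 0) (ys ! 1) (tl (tl ys)))"
  shows "recursive_in A n (\<lambda>xs. rec_nat (g xs) (\<lambda>k r. h k r xs) (f xs))"
proof -
  obtain p where p: "\<And>xs. length xs = n \<Longrightarrow> eval A p xs = Some (g xs)"
    using g unfolding recursive_in_def by blast
  obtain q where q: "\<And>ys. length ys = Suc (Suc n) \<Longrightarrow> eval A q ys = Some (h (ys ! 0) (ys ! 1) (tl (tl ys)))"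
    using h unfolding recursive_in_def by blast
  have *: "eval A (PrimRec p q) (m # xs) = Some (rec_nat (g xs) (\<lambda>k r. h k r xs) m)"
    if "length xs = n" for m xs
    using that by (induction m) (simp_all add: p q)
  have r: "recursive_in A (Suc n) (\<lambda>ys. rec_nat (g (tl ys)) (\<lambda>k r. h k r (tl ys)) (ys ! 0))"
    unfolding recursive_in_def
  proof (intro exI allI impI)
    fix ys :: "nat list"
    assume "length ys = Suc n"
    then obtain m xs where "ys = m # xs" "length xs = n"
      by (cases ys) auto
    with *[of xs m] show "eval A (PrimRec p q) ys
        = Some (rec_nat (g (tl ys)) (\<lambda>k r. h k r (tl ys)) (ys ! 0))"
      by (simp del: eval.simps)
  qed
  let ?fs = "f # map (\<lambda>i xs. xs ! i) [0..<n]"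
  show ?thesis
  proof (rule recursive_in_cong)
    show "recursive_in A n (\<lambda>xs. (\<lambda>ys. rec_nat (g (tl ys)) (\<lambda>k r. h k r (tl ys)) (ys ! 0))
        (map (\<lambda>f. f xs) ?fs))"
      by (rule recursive_in_subst[OF r]) (use f in \<open>auto intro!: rec_intros\<close>)
    fix xs :: "nat list" assume "length xs = n"
    then have "map (\<lambda>f. f xs) ?fs = f xs # xs"
      by (auto simp: map_nth comp_def)
    then show "(\<lambda>ys. rec_nat (g (tl ys)) (\<lambda>k r. h k r (tl ys)) (ys ! 0)) (map (\<lambda>f. f xs) ?fs)
      = rec_nat (g xs) (\<lambda>k r. h k r xs) (f xs)"
      by simp
  qed
qed

lemma recursive_in_add [rec_intros]:
  assumes "recursive_in A n f" "recursive_in A n g"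
  shows "recursive_in A n (\<lambda>xs. f xs + g xs)"
proof -
  have "rec_nat b (\<lambda>_ r. Suc r) a = a + b" for a b :: nat
    by (induction a) auto
  moreover have "recursive_in A n (\<lambda>xs. rec_nat (g xs) (\<lambda>_ r. Suc r) (f xs))"
    by (intro recursive_in_rec_nat assms rec_intros) simp
  ultimately show ?thesis by simp
qed

lemma recursive_in_mult [rec_intros]:
  assumes "recursive_in A n f" "recursive_in A n g"
  shows "recursive_in A n (\<lambda>xs. f xs * g xs)"
proof -
  have "rec_nat 0 (\<lambda>_ r. r + b) a = a * b" for a b :: nat
    by (induction a) auto
  moreover have "recursive_in A n (\<lambda>xs. rec_nat 0 (\<lambda>_ r. r + g xs) (f xs))"
    by (intro recursive_in_rec_nat assms rec_intros recursive_in_tl2) simp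
  ultimately show ?thesis by simp
qed

lemma recursive_in_diff [rec_intros]:
  assumes "recursive_in A n f" "recursive_in A n g"
  shows "recursive_in A n (\<lambda>xs. f xs - g xs)"
proof -
  have pred: "recursive_in A m (\<lambda>xs. e xs - 1)" if "recursive_in A m e" for m e
  proof -
    have "rec_nat 0 (\<lambda>k _. k) a = a - 1" for a :: nat
      by (cases a) auto
    moreover have "recursive_in A m (\<lambda>xs. rec_nat 0 (\<lambda>k _. k) (e xs))"
      by (intro recursive_in_rec_nat that rec_intros) simp
    ultimately show ?thesis by simp
  qed
  have "rec_nat a (\<lambda>_ r. r - 1) b = a - b" for a b :: nat
    by (induction b) auto
  moreover have "recursive_in A n (\<lambda>xs. rec_nat (f xs) (\<lambda>_ r. r - 1) (g xs))"
    by (intro recursive_in_rec_nat assms pred rec_intros) simp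
  ultimately show ?thesis by simp
qed

lemma recursive_in_power [rec_intros]:
  assumes "recursive_in A n f" "recursive_in A n g"
  shows "recursive_in A n (\<lambda>xs. f xs ^ g xs)"
proof -
  have "rec_nat 1 (\<lambda>_ r. r * a) b = a ^ b" for a b :: nat
    by (induction b) auto
  moreover have "recursive_in A n (\<lambda>xs. rec_nat 1 (\<lambda>_ r. r * f xs) (g xs))"
    by (intro recursive_in_rec_nat assms rec_intros recursive_in_tl2) simp
  ultimately show ?thesis by simp
qed

lemma recursive_in_fact [rec_intros]:
  assumes "recursive_in A n f"
  shows "recursive_in A n (\<lambda>xs. fact (f xs))"
proof -
  have "rec_nat 1 (\<lambda>k r. Suc k * r) a = (fact a :: nat)" for a
    by (induction a) auto
  moreover have "recursive_in A n (\<lambda>xs. rec_nat 1 (\<lambda>k r. Suc k * r) (f xs))"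
    by (intro recursive_in_rec_nat assms rec_intros) simp_all
  ultimately show ?thesis by simp
qed

lemma recursive_in_sum [rec_intros]:
  assumes "recursive_in A n b" "recursive_in A (Suc n) (\<lambda>ys. f (ys ! 0) (tl ys))"
  shows "recursive_in A n (\<lambda>xs. \<Sum>i<b xs. f i xs)"
proof -
  have "rec_nat 0 (\<lambda>k r. r + f k xs) m = (\<Sum>i<m. f i xs)" for m xs
    by (induction m) auto
  moreover have "recursive_in A (Suc (Suc n))
      (\<lambda>ys. (\<lambda>zs. f (zs ! 0) (tl zs)) (map (\<lambda>g. g ys) ((\<lambda>ys. ys ! 0) # map (\<lambda>i ys. ys ! Suc (Suc i)) [0..<n])))"
    by (rule recursive_in_subst[OF assms(2)]) (auto intro!: rec_intros)
  then have "recursive_in A (Suc (Suc n)) (\<lambda>ys. f (ys ! 0) (tl (tl ys)))"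
    by (rule recursive_in_cong) (auto intro!: arg_cong2[where f = f] nth_equalityI simp: nth_tl)
  then have "recursive_in A n (\<lambda>xs. rec_nat 0 (\<lambda>k r. r + f k xs) (b xs))"
    by (intro recursive_in_rec_nat assms rec_intros) simp_all
  ultimately show ?thesis by simp
qed

lemma decidable_in_not [rec_intros]:
  assumes "decidable_in A n P" shows "decidable_in A n (\<lambda>xs. \<not> P xs)"
proof (rule recursive_in_cong)
  show "recursive_in A n (\<lambda>xs. 1 - of_bool (P xs))"
    by (intro rec_intros assms)
qed simp

lemma decidable_in_conj [rec_intros]:
  assumes "decidable_in A n P" "decidable_in A n Q" shows "decidable_in A n (\<lambda>xs. P xs \<and> Q xs)"
  unfolding of_bool_conj by (intro rec_intros assms)

lemma decidable_in_disj [rec_intros]: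
  assumes "decidable_in A n P" "decidable_in A n Q" shows "decidable_in A n (\<lambda>xs. P xs \<or> Q xs)"
  using decidable_in_not[OF decidable_in_conj[OF assms[THEN decidable_in_not]]] by simp

lemma decidable_in_le [rec_intros]:
  assumes "recursive_in A n f" "recursive_in A n g" shows "decidable_in A n (\<lambda>xs. f xs \<le> g xs)"
  by (rule recursive_in_cong[of A n "\<lambda>xs. 1 - (f xs - g xs)"]) (intro rec_intros assms, auto)

lemma decidable_in_less [rec_intros]:
  assumes "recursive_in A n f" "recursive_in A n g" shows "decidable_in A n (\<lambda>xs. f xs < g xs)"
  using decidable_in_not[OF decidable_in_le[OF assms(2,1)]] by (simp add: not_le)

lemma decidable_in_eq [rec_intros]:
  assumes "recursive_in A n f" "recursive_in A n g" shows "decidable_in A n (\<lambda>xs. f xs = g xs)"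
  using decidable_in_conj[OF decidable_in_le[OF assms] decidable_in_le[OF assms(2,1)]]
  by (simp add: eq_iff)

lemma recursive_in_if [rec_intros]:
  assumes "decidable_in A n P" "recursive_in A n f" "recursive_in A n g"
  shows "recursive_in A n (\<lambda>xs. if P xs then f xs else g xs)"
  by (rule recursive_in_cong[of A n "\<lambda>xs. of_bool (P xs) * f xs + (1 - of_bool (P xs)) * g xs"])
    (intro rec_intros assms, auto)

lemma decidable_in_bex [rec_intros]:
  assumes "recursive_in A n b" "decidable_in A (Suc n) (\<lambda>ys. P (ys ! 0) (tl ys))"
  shows "decidable_in A n (\<lambda>xs. \<exists>i<b xs. P i xs)"
proof (rule recursive_in_cong)
  show "decidable_in A n (\<lambda>xs. 0 < (\<Sum>i<b xs. of_bool (P i xs) :: nat))"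
    by (intro rec_intros assms)
  show "of_bool (0 < (\<Sum>i<b xs. of_bool (P i xs) :: nat)) = of_bool (\<exists>i<b xs. P i xs)" for xs
    by (auto simp: zero_less_iff_neq_zero simp del: sum_of_bool_eq)
qed

lemma decidable_in_ball [rec_intros]:
  assumes "recursive_in A n b" "decidable_in A (Suc n) (\<lambda>ys. P (ys ! 0) (tl ys))"
  shows "decidable_in A n (\<lambda>xs. \<forall>i<b xs. P i xs)"
  using decidable_in_not[OF decidable_in_bex[OF assms(1) decidable_in_not[OF assms(2)]]] by simp

lemma recursive_in_Least [rec_intros]:
  assumes P: "decidable_in A (Suc n) (\<lambda>ys. P (ys ! 0) (tl ys))"
    and ex: "\<And>xs. length xs = n \<Longrightarrow> \<exists>z. P z xs"
  shows "recursive_in A n (\<lambda>xs. LEAST z. P z xs)"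
proof -
  \<comment> \<open>\<open>Mu\<close> looks for a zero, so the search runs on the negated
    predicate.\<close>
  from decidable_in_not[OF P] obtain p where
    p: "\<And>ys. length ys = Suc n \<Longrightarrow> eval A p ys = Some (of_bool (\<not> P (ys ! 0) (tl ys)))"
    unfolding recursive_in_def by blast
  have "eval A (Mu p) xs = Some (LEAST z. P z xs)" if "length xs = n" for xs
    using ex[OF that] that by (auto simp: p)
  then show ?thesis unfolding recursive_in_def by blast
qed

lemma semidecidable_if_decidable:
  assumes "decidable_in A n P"
  obtains p where "\<And>xs. length xs = n \<Longrightarrow> eval A p xs \<noteq> None \<longleftrightarrow> P xs"
proof -
  \<comment> \<open>The searched function ignores its search variable: \<open>Mu\<close> stops at
    once if the predicate holds and never otherwise.\<close>
  from recursive_in_tl[OF decidable_in_not[OF assms]] obtain p where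
    p: "\<And>ys. length ys = Suc n \<Longrightarrow> eval A p ys = Some (of_bool (\<not> P (tl ys)))"
    unfolding recursive_in_def by blast
  have "eval A (Mu p) xs \<noteq> None \<longleftrightarrow> P xs" if "length xs = n" for xs
    using that by (auto simp: p)
  then show ?thesis using that by blast
qed

lemma recursive_in_div [rec_intros]:
  assumes "recursive_in A n f" "recursive_in A n g"
  shows "recursive_in A n (\<lambda>xs. f xs div g xs)"
proof (rule recursive_in_cong)
  \<comment> \<open>The disjunct \<open>g xs = 0\<close> keeps the search total and returns 0, which
    is the value of division by zero.\<close>
  show "recursive_in A n (\<lambda>xs. LEAST q. g xs = 0 \<or> f xs < Suc q * g xs)"
  proof (intro rec_intros recursive_in_tl[OF assms(1)] recursive_in_tl[OF assms(2)])
    show "\<exists>q. g xs = 0 \<or> f xs < Suc q * g xs" for xs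
      by (metis dividend_less_times_div gr0I mult.commute mult_Suc_right)
  qed auto
  fix xs :: "nat list"
  show "(LEAST q. g xs = 0 \<or> f xs < Suc q * g xs) = f xs div g xs"
  proof (cases "g xs = 0")
    case False
    then have "f xs < Suc q * g xs \<longleftrightarrow> f xs div g xs \<le> q" for q
      using div_less_iff_less_mult[of "g xs" "f xs" "Suc q"] by (simp add: less_Suc_eq_le)
    with False show ?thesis
      by (intro Least_equality) (simp_all del: mult_Suc)
  next
    case True
    then show ?thesis
      by (simp add: Least_eq_0)
  qed
qed

lemma decidable_in_odd [rec_intros]:
  assumes "recursive_in A n f" shows "decidable_in A n (\<lambda>xs. odd (f xs))"
proof -
  have odd: "odd a \<longleftrightarrow> 2 * (a div 2) \<noteq> a" for a :: nat
    by presburger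
  show ?thesis
    unfolding odd by (intro rec_intros assms)
qed

lemma decidable_in_set_decode [rec_intros]:
  assumes "recursive_in A n f" "recursive_in A n g"
  shows "decidable_in A n (\<lambda>xs. f xs \<in> set_decode (g xs))"
  unfolding set_decode_def mem_Collect_eq by (intro rec_intros assms)

lemma recursive_in_prod_encode [rec_intros]:
  assumes "recursive_in A n f" "recursive_in A n g"
  shows "recursive_in A n (\<lambda>xs. prod_encode (f xs, g xs))"
  unfolding prod_encode_def triangle_def split_conv by (intro rec_intros assms)

text \<open>Both components of a pair are at most its code. One is found by a search, the other is
  bounded inside it.\<close>

lemma recursive_in_prod_decode [rec_intros]:
  assumes "recursive_in A n f"
  shows "recursive_in A n (\<lambda>xs. fst (prod_decode (f xs)))" 
    and "recursive_in A n (\<lambda>xs. snd (prod_decode (f xs)))"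
proof -
  have fst: "(LEAST a. \<exists>b<Suc c. prod_encode (a, b) = c) = fst (prod_decode c)" 
    and snd: "(LEAST b. \<exists>a<Suc c. prod_encode (a, b) = c) = snd (prod_decode c)"
    and ex: "\<exists>a. \<exists>b<Suc c. prod_encode (a, b) = c" "\<exists>b. \<exists>a<Suc c. prod_encode (a, b) = c" for c
  proof -
    obtain a b where c: "c = prod_encode (a, b)"
      by (metis prod_decode_inverse surj_pair)
    have "a < Suc c" "b < Suc c"
      unfolding c by (simp_all add: less_Suc_eq_le le_prod_encode_1 le_prod_encode_2)
    then show "(LEAST a. \<exists>b<Suc c. prod_encode (a, b) = c) = fst (prod_decode c)"
      "(LEAST b. \<exists>a<Suc c. prod_encode (a, b) = c) = snd (prod_decode c)"
      "\<exists>a. \<exists>b<Suc c. prod_encode (a, b) = c" "\<exists>b. \<exists>a<Suc c. prod_encode (a, b) = c"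
      unfolding c by (auto intro!: Least_equality simp: prod_encode_eq)
  qed
  show "recursive_in A n (\<lambda>xs. fst (prod_decode (f xs)))"
    unfolding fst[symmetric]
    by (intro rec_intros ex recursive_in_tl2[OF assms] recursive_in_tl[OF assms]) simp_all
  show "recursive_in A n (\<lambda>xs. snd (prod_decode (f xs)))"
    unfolding snd[symmetric]
    by (intro rec_intros ex recursive_in_tl2[OF assms] recursive_in_tl[OF assms]) simp_all
qed

section \<open>Bounded evaluation and the jump\<close>

text \<open>A single bound limits both \<open>Mu\<close>-searches and oracle queries, so that a finite initial
  segment of the oracle also serves as the number of steps.\<close>

primrec eval_upto :: "nat \<Rightarrow> nat set \<Rightarrow> prog \<Rightarrow> nat list \<Rightarrow> nat option" where
  "eval_upto s A Zero = (\<lambda>xs. Some 0)"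
| "eval_upto s A Succ = (\<lambda>xs. case xs of [] \<Rightarrow> None | x # _ \<Rightarrow> Some (Suc x))"
| "eval_upto s A (Proj i) = (\<lambda>xs. if i < length xs then Some (xs ! i) else None)"
| "eval_upto s A Oracle =
     (\<lambda>xs. case xs of [] \<Rightarrow> None | x # _ \<Rightarrow> if x < s then Some (of_bool (x \<in> A)) else None)"
| "eval_upto s A (Comp p qs) = (\<lambda>xs.
     let ys = map (\<lambda>f. f xs) (map (eval_upto s A) qs)
     in if None \<in> set ys then None else eval_upto s A p (map the ys))"
| "eval_upto s A (PrimRec p q) = (\<lambda>xs. case xs of
       [] \<Rightarrow> None
     | n # zs \<Rightarrow>
         rec_nat (eval_upto s A p zs) (\<lambda>k r. Option.bind r (\<lambda>y. eval_upto s A q (k # y # zs))) n)"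
| "eval_upto s A (Mu p) = (\<lambda>xs.
     let z = (LEAST z. s \<le> z \<or> eval_upto s A p (z # xs) = Some 0 \<and>
                (\<forall>m<z. eval_upto s A p (m # xs) \<noteq> None))
     in if z < s then Some z else None)"

declare eval_upto.simps(5) [simp del] eval_upto.simps(7) [simp del]

text \<open>Strict composition has the same shape in \<open>eval\<close> and in
  \<open>eval_upto\<close>; this turns both into the existence of a list of intermediate
  values.\<close>

lemma map_option_list_eq_Some:
  "(if None \<in> set ys then None else f (map the ys)) = Some y
    \<longleftrightarrow> (\<exists>zs. ys = map Some zs \<and> f zs = Some y)"
proof
  assume *: "(if None \<in> set ys then None else f (map the ys)) = Some y"
  then have "None \<notin> set ys"
    by (auto split: if_splits)
  then have "Some (the r) = r" if "r \<in> set ys" for r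
    using that by (cases r) auto
  then have "ys = map Some (map the ys)"
    by (simp add: comp_def map_idI)
  with * show "\<exists>zs. ys = map Some zs \<and> f zs = Some y"
    by (metis option.distinct(1))
qed (auto simp: comp_def)

lemma eval_Comp_iff:
  "eval A (Comp p qs) xs = Some y
    \<longleftrightarrow> (\<exists>ys. map (\<lambda>q. eval A q xs) qs = map Some ys \<and> eval A p ys = Some y)"
  unfolding eval.simps Let_def map_option_list_eq_Some by (simp add: comp_def)

lemma eval_upto_Comp_iff:
  "eval_upto s A (Comp p qs) xs = Some y
    \<longleftrightarrow> (\<exists>ys. map (\<lambda>q. eval_upto s A q xs) qs = map Some ys \<and> eval_upto s A p ys = Some y)"
  unfolding eval_upto.simps Let_def map_option_list_eq_Some by (simp add: comp_def)

text \<open>The LEAST in the semantics ignores convergence. The least zero lies at or below the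
  witness of the condition, so every earlier value does converge, and to a successor.\<close>

lemma eval_Mu_iff:
  "eval A (Mu p) xs = Some z
    \<longleftrightarrow> eval A p (z # xs) = Some 0 \<and> (\<forall>m<z. \<exists>y. eval A p (m # xs) = Some (Suc y))"
proof
  assume *: "eval A (Mu p) xs = Some z"
  then obtain n where n: "eval A p (n # xs) = Some 0" "\<forall>m<n. eval A p (m # xs) \<noteq> None"
    and z: "z = (LEAST n. eval A p (n # xs) = Some 0)"
    by (auto split: if_splits)
  have "eval A p (z # xs) = Some 0" "z \<le> n" and not: "eval A p (m # xs) \<noteq> Some 0" if "m < z" for m
    unfolding z using n(1) that[unfolded z] by (auto intro: LeastI Least_le dest: not_less_Least)
  moreover have "eval A p (z # xs) = Some 0" "z \<le> n"
    unfolding z using n(1) by (auto intro: LeastI Least_le)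
  moreover have "\<exists>y. eval A p (m # xs) = Some (Suc y)" if "m < z" for m
  proof -
    have "m < n" using that \<open>z \<le> n\<close> by simp
    then show ?thesis using n(2) not[OF that] by (metis not0_implies_Suc option.exhaust)
  qed
  ultimately show "eval A p (z # xs) = Some 0 \<and> (\<forall>m<z. \<exists>y. eval A p (m # xs) = Some (Suc y))"
    by blast
next
  assume *: "eval A p (z # xs) = Some 0 \<and> (\<forall>m<z. \<exists>y. eval A p (m # xs) = Some (Suc y))"
  then have conv: "eval A p (m # xs) \<noteq> None \<and> eval A p (m # xs) \<noteq> Some 0" if "m < z" for m
    using that by fastforce
  with * have "(LEAST n. eval A p (n # xs) = Some 0) = z"
    by (intro Least_equality) (auto simp: not_less[symmetric])
  moreover have "\<exists>n. eval A p (n # xs) = Some 0 \<and> (\<forall>m<n. eval A p (m # xs) \<noteq> None)"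
    using * conv by blast
  ultimately show "eval A (Mu p) xs = Some z"
    by simp
qed

text \<open>The disjunct \<open>s \<le> z\<close> makes the LEAST exist in all cases, so that the
  bounded search is computable; the result \<open>s\<close> then signals failure.\<close>

lemma eval_upto_Mu_iff:
  "eval_upto s A (Mu p) xs = Some z
    \<longleftrightarrow> z < s \<and> eval_upto s A p (z # xs) = Some 0 \<and>
      (\<forall>m<z. \<exists>y. eval_upto s A p (m # xs) = Some (Suc y))"
proof -
  define Q where "Q z \<longleftrightarrow> s \<le> z \<or> eval_upto s A p (z # xs) = Some 0 \<and>
      (\<forall>m<z. eval_upto s A p (m # xs) \<noteq> None)" for z
  have eq: "eval_upto s A (Mu p) xs = (if (LEAST z. Q z) < s then Some (LEAST z. Q z) else None)"
    unfolding eval_upto.simps Let_def Q_def ..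
  have Q: "Q (LEAST z. Q z)"
    by (rule LeastI[of Q s]) (simp add: Q_def)
  show ?thesis
  proof
    assume "eval_upto s A (Mu p) xs = Some z"
    then have z: "(LEAST z. Q z) = z" "z < s"
      unfolding eq by (auto split: if_splits)
    have "\<not> Q m" if "m < z" for m
      using that not_less_Least z(1) by blast
    moreover from Q z have 0: "eval_upto s A p (z # xs) = Some 0"
      and conv: "\<forall>m<z. eval_upto s A p (m # xs) \<noteq> None"
      unfolding Q_def by auto
    ultimately have "eval_upto s A p (m # xs) \<noteq> None \<and> eval_upto s A p (m # xs) \<noteq> Some 0"
      if "m < z" for m
      using that unfolding Q_def by (meson order.strict_trans)
    with z(2) 0 show "z < s \<and> eval_upto s A p (z # xs) = Some 0 \<and>
      (\<forall>m<z. \<exists>y. eval_upto s A p (m # xs) = Some (Suc y))"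
      by (metis not0_implies_Suc option.exhaust)
  next
    assume *: "z < s \<and> eval_upto s A p (z # xs) = Some 0 \<and>
      (\<forall>m<z. \<exists>y. eval_upto s A p (m # xs) = Some (Suc y))"
    then have "Q z"
      unfolding Q_def by (metis option.distinct(1))
    moreover have "\<not> Q m" if m: "m < z" for m
    proof -
      obtain y where "eval_upto s A p (m # xs) = Some (Suc y)"
        using * m by blast
      then show ?thesis
        unfolding Q_def using * m by auto
    qed
    ultimately have "(LEAST z. Q z) = z"
      by (intro Least_equality) (auto simp: not_less[symmetric])
    with * show "eval_upto s A (Mu p) xs = Some z"
      unfolding eq by simp
  qed
qed

lemma eval_upto_local:
  assumes "A \<inter> {..<s} = B \<inter> {..<s}"
  shows "eval_upto s A p = eval_upto s B p"
proof (induction p)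
  case Oracle
  have "x \<in> A \<longleftrightarrow> x \<in> B" if "x < s" for x
    using assms that by blast
  then show ?case by (auto split: list.splits)
next
  case (Comp p qs)
  then have "map (eval_upto s A) qs = map (eval_upto s B) qs"
    by simp
  with Comp.IH(1) show ?case
    by (simp only: eval_upto.simps)
next
  case (PrimRec p q)
  then show ?case by (simp only: eval_upto.simps)
qed (simp_all add: eval_upto.simps(7))

lemma eval_upto_mono:
  "eval_upto s A p xs = Some y \<Longrightarrow> s \<le> t \<Longrightarrow> eval_upto t A p xs = Some y"
proof (induction p arbitrary: xs y)
  case Oracle
  then show ?case by (auto split: list.splits if_splits)
next
  case (Comp p qs)
  then obtain ys where ys: "map (\<lambda>q. eval_upto s A q xs) qs = map Some ys"
    and y: "eval_upto s A p ys = Some y"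
    unfolding eval_upto_Comp_iff by blast
  have "map (\<lambda>q. eval_upto t A q xs) qs = map Some ys"
  proof (rule nth_equalityI)
    fix i assume i: "i < length (map (\<lambda>q. eval_upto t A q xs) qs)"
    then have "eval_upto s A (qs ! i) xs = Some (ys ! i)"
      using arg_cong[OF ys, of "\<lambda>l. l ! i"] arg_cong[OF ys, of length] by simp
    then show "map (\<lambda>q. eval_upto t A q xs) qs ! i = map Some ys ! i"
      using Comp.IH(2)[of "qs ! i"] Comp.prems(2) i arg_cong[OF ys, of length] by simp
  qed (use arg_cong[OF ys, of length] in simp)
  with y Comp show ?case
    unfolding eval_upto_Comp_iff by blast
next
  case (PrimRec p q)
  then obtain n zs where xs: "xs = n # zs"
    by (cases xs) auto
  have "eval_upto s A (PrimRec p q) (n # zs) = Some y \<Longrightarrow>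
      eval_upto t A (PrimRec p q) (n # zs) = Some y"
    using PrimRec.prems(2)
    by (induction n arbitrary: y) (auto simp: bind_eq_Some_conv PrimRec.IH)
  then show ?case using PrimRec.prems xs by simp
next
  case (Mu p)
  then show ?case
    unfolding eval_upto_Mu_iff by (auto dest: Mu.IH)
qed auto

lemma eval_if_eval_upto:
  "eval_upto s A p xs = Some y \<Longrightarrow> eval A p xs = Some y"
proof (induction p arbitrary: xs y)
  case Oracle
  then show ?case by (auto split: list.splits if_splits)
next
  case (Comp p qs)
  then obtain ys where ys: "map (\<lambda>q. eval_upto s A q xs) qs = map Some ys"
    and y: "eval_upto s A p ys = Some y"
    unfolding eval_upto_Comp_iff by blast
  have "map (\<lambda>q. eval A q xs) qs = map Some ys"
  proof (rule nth_equalityI)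
    fix i assume i: "i < length (map (\<lambda>q. eval A q xs) qs)"
    then have "eval_upto s A (qs ! i) xs = Some (ys ! i)"
      using arg_cong[OF ys, of "\<lambda>l. l ! i"] arg_cong[OF ys, of length] by simp
    then show "map (\<lambda>q. eval A q xs) qs ! i = map Some ys ! i"
      using Comp.IH(2)[of "qs ! i"] i arg_cong[OF ys, of length] by simp
  qed (use arg_cong[OF ys, of length] in simp)
  with y Comp show ?case
    unfolding eval_Comp_iff by blast
next
  case (PrimRec p q)
  then obtain n zs where xs: "xs = n # zs"
    by (cases xs) auto
  have "eval_upto s A (PrimRec p q) (n # zs) = Some y \<Longrightarrow>
      eval A (PrimRec p q) (n # zs) = Some y"
    by (induction n arbitrary: y) (auto simp: bind_eq_Some_conv PrimRec.IH)
  then show ?case using PrimRec.prems xs by simp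
next
  case (Mu p)
  then show ?case
    unfolding eval_upto_Mu_iff eval_Mu_iff by blast
qed auto

text \<open>A convergent computation has finitely many immediate subcomputations in each clause,
  each correct from some stage on, hence all correct from a common stage on.\<close>

lemma eventually_eval_upto:
  "eval A p xs = Some y \<Longrightarrow> \<forall>\<^sub>F s in sequentially. eval_upto s A p xs = Some y"
proof (induction p arbitrary: xs y)
  case Oracle
  then obtain x zs where "xs = x # zs"
    by (cases xs) auto
  with Oracle show ?case
    using eventually_gt_at_top[of x] by (auto elim!: eventually_mono)
next
  case (Comp p qs)
  then obtain ys where ys: "map (\<lambda>q. eval A q xs) qs = map Some ys"
    and y: "eval A p ys = Some y"
    unfolding eval_Comp_iff by blast
  have len: "length qs = length ys"
    using arg_cong[OF ys, of length] by simp
  have "\<forall>\<^sub>F s in sequentially. \<forall>i\<in>{..<length qs}. eval_upto s A (qs ! i) xs = Some (ys ! i)"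
  proof (intro eventually_ball_finite ballI)
    fix i assume i: "i \<in> {..<length qs}"
    then have "eval A (qs ! i) xs = Some (ys ! i)"
      using arg_cong[OF ys, of "\<lambda>l. l ! i"] len by simp
    then show "\<forall>\<^sub>F s in sequentially. eval_upto s A (qs ! i) xs = Some (ys ! i)"
      using Comp.IH(2)[of "qs ! i"] i by simp
  qed simp
  with Comp.IH(1)[OF y] show ?case
  proof eventually_elim
    case (elim s)
    then have "map (\<lambda>q. eval_upto s A q xs) qs = map Some ys"
      using len by (intro nth_equalityI) auto
    with elim show ?case
      unfolding eval_upto_Comp_iff by blast
  qed
next
  case (PrimRec p q)
  then obtain n zs where xs: "xs = n # zs"
    by (cases xs) auto
  have "eval A (PrimRec p q) (n # zs) = Some y \<Longrightarrow>
      \<forall>\<^sub>F s in sequentially. eval_upto s A (PrimRec p q) (n # zs) = Some y"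
  proof (induction n arbitrary: y)
    case 0
    then show ?case by (simp add: PrimRec.IH)
  next
    case (Suc n)
    then obtain r where r: "eval A (PrimRec p q) (n # zs) = Some r" "eval A q (n # r # zs) = Some y"
      by (auto simp: bind_eq_Some_conv)
    from Suc.IH[OF r(1)] PrimRec.IH(2)[OF r(2)] show ?case
      by eventually_elim simp
  qed
  then show ?case using PrimRec.prems xs by simp
next
  case (Mu p)
  then have z: "eval A p (y # xs) = Some 0"
    and m: "\<And>m. m < y \<Longrightarrow> \<exists>r. eval A p (m # xs) = Some (Suc r)"
    unfolding eval_Mu_iff by auto
  have "\<forall>\<^sub>F s in sequentially. \<forall>m\<in>{..<y}. \<exists>r. eval_upto s A p (m # xs) = Some (Suc r)"
  proof (intro eventually_ball_finite ballI)
    fix k assume "k \<in> {..<y}"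
    then obtain r where "eval A p (k # xs) = Some (Suc r)"
      using m by auto
    from Mu.IH[OF this] show "\<forall>\<^sub>F s in sequentially. \<exists>r. eval_upto s A p (k # xs) = Some (Suc r)"
      by eventually_elim auto
  qed simp
  with Mu.IH[OF z] eventually_gt_at_top[of y] show ?case
    by eventually_elim (auto simp: eval_upto_Mu_iff)
qed auto

lemma eval_iff_eval_upto: "eval A p xs = Some y \<longleftrightarrow> (\<exists>s. eval_upto s A p xs = Some y)"
  using eventually_happens'[OF sequentially_bot eventually_eval_upto] eval_if_eval_upto by blast

section \<open>Bounded evaluation is recursive in its bound, oracle parameters and arguments\<close>

definition option_code :: "nat option \<Rightarrow> nat" where
  "option_code r = (case r of None \<Rightarrow> 0 | Some y \<Rightarrow> Suc y)"

lemma option_code_simps [simp]: 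
  "option_code None = 0" "option_code (Some y) = Suc y"
  "option_code r = 0 \<longleftrightarrow> r = None" "0 < option_code r \<longleftrightarrow> r \<noteq> None"
  "option_code r = Suc y \<longleftrightarrow> r = Some y"
  by (auto simp: option_code_def split: option.splits)

lemma option_code_if: "option_code (if P then r else t) = (if P then option_code r else option_code t)"
  by simp

lemma decidable_in_list_ex:
  assumes "\<And>g. g \<in> set gs \<Longrightarrow> decidable_in A n g"
  shows "decidable_in A n (\<lambda>xs. \<exists>g\<in>set gs. g xs)"
  using assms
proof (induction gs)
  case Nil
  then show ?case using recursive_in_const[of A n 0] by simp
next
  case (Cons g gs)
  then have "decidable_in A n (\<lambda>xs. g xs \<or> (\<exists>g\<in>set gs. g xs))"
    by (intro rec_intros) simp_all
  then show ?case by simp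
qed

text \<open>The program \<open>p\<close> is fixed, so induction on it assembles a program for its
  bounded evaluation clause by clause. The arity and all recursive parameters are generalised
  because \<open>PrimRec\<close> and \<open>Mu\<close> evaluate their bodies under additional
  variables. The family \<open>B\<close> of oracles later consists of the sets
  \<open>\<I> (set_decode y - {n})\<close>, with \<open>n\<close> and \<open>y\<close> among the
  inputs.\<close>

lemma recursive_in_eval_upto:
  fixes B :: "nat \<Rightarrow> nat \<Rightarrow> nat set"
  assumes B: "decidable_in A 3 (\<lambda>xs. xs ! 0 \<in> B (xs ! 1) (xs ! 2))"
    and "recursive_in A n s" "recursive_in A n a" "recursive_in A n b"
    and "\<And>f. f \<in> set fs \<Longrightarrow> recursive_in A n f"
  shows "recursive_in A n
    (\<lambda>xs. option_code (eval_upto (s xs) (B (a xs) (b xs)) p (map (\<lambda>f. f xs) fs)))"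
  using assms(2-)
proof (induction p arbitrary: n s a b fs)
  case Zero
  show ?case by (simp, intro rec_intros)
next
  case Succ
  then show ?case by (cases fs) (auto intro!: rec_intros)
next
  case (Proj i)
  show ?case
  proof (cases "i < length fs")
    case True
    then have "recursive_in A n (\<lambda>xs. Suc ((fs ! i) xs))"
      by (intro rec_intros Proj.prems) simp
    with True show ?thesis by simp
  qed (simp, intro rec_intros)
next
  case Oracle
  show ?case
  proof (cases fs)
    case (Cons f fs')
    then have f: "recursive_in A n f" using Oracle by simp
    have mem: "decidable_in A n (\<lambda>xs. f xs \<in> B (a xs) (b xs))"
      using recursive_in_subst3[where g = "\<lambda>x a b. of_bool (x \<in> B a b)", OF B f Oracle.prems(2,3)] .
    have "recursive_in A n (\<lambda>xs. if f xs < s xs then Suc (of_bool (f xs \<in> B (a xs) (b xs))) else 0)"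
      by (intro mem rec_intros Oracle.prems(1) f)
    then show ?thesis
      by (rule recursive_in_cong) (simp add: Cons)
  qed (simp, intro rec_intros)
next
  case (Comp p qs)
  define g where "g q xs = option_code (eval_upto (s xs) (B (a xs) (b xs)) q (map (\<lambda>f. f xs) fs))" for q xs
  have g: "recursive_in A n (g q)" if "q \<in> set qs" for q
    unfolding g_def using Comp.IH(2)[OF that Comp.prems] .
  have "decidable_in A n (\<lambda>xs. \<exists>h\<in>set (map (\<lambda>q xs. g q xs = 0) qs). h xs)"
    by (rule decidable_in_list_ex) (auto intro!: decidable_in_eq recursive_in_const g)
  moreover have "recursive_in A n (\<lambda>xs. option_code (eval_upto (s xs) (B (a xs) (b xs)) p
        (map (\<lambda>f. f xs) (map (\<lambda>q xs. g q xs - 1) qs))))"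
    by (rule Comp.IH(1)[OF Comp.prems(1-3)]) (auto intro!: recursive_in_diff recursive_in_const g)
  ultimately have "recursive_in A n (\<lambda>xs. if \<exists>h\<in>set (map (\<lambda>q xs. g q xs = 0) qs). h xs then 0
      else option_code (eval_upto (s xs) (B (a xs) (b xs)) p
        (map (\<lambda>f. f xs) (map (\<lambda>q xs. g q xs - 1) qs))))"
    by (intro recursive_in_if recursive_in_const)
  then show ?case
  proof (rule recursive_in_cong)
    fix xs
    have "None \<in> set (map (\<lambda>f. f (map (\<lambda>f. f xs) fs)) (map (eval_upto (s xs) (B (a xs) (b xs))) qs))
      \<longleftrightarrow> (\<exists>h\<in>set (map (\<lambda>q xs. g q xs = 0) qs). h xs)"
      by (auto simp: g_def eq_commute[of None])
    moreover have "map the (map (\<lambda>f. f (map (\<lambda>f. f xs) fs)) (map (eval_upto (s xs) (B (a xs) (b xs))) qs))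
      = map (\<lambda>f. f xs) (map (\<lambda>q xs. g q xs - 1) qs)"
      if "\<not> (\<exists>h\<in>set (map (\<lambda>q xs. g q xs = 0) qs). h xs)"
      using that by (auto simp: g_def)
    ultimately show "(if \<exists>h\<in>set (map (\<lambda>q xs. g q xs = 0) qs). h xs then 0
      else option_code (eval_upto (s xs) (B (a xs) (b xs)) p
        (map (\<lambda>f. f xs) (map (\<lambda>q xs. g q xs - 1) qs)))) =
      option_code (eval_upto (s xs) (B (a xs) (b xs)) (Comp p qs) (map (\<lambda>f. f xs) fs))"
      unfolding eval_upto.simps Let_def option_code_if option_code_simps(1) by (metis (no_types, lifting))
  qed
next
  case (PrimRec p q)
  show ?case
  proof (cases fs)
    case (Cons f fs')
    then have f: "recursive_in A n f" and fs': "\<And>f. f \<in> set fs' \<Longrightarrow> recursive_in A n f"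
      using PrimRec.prems by simp_all
    let ?e = "\<lambda>p xs. eval_upto (s xs) (B (a xs) (b xs)) p"
    let ?gs = "(\<lambda>ys. ys ! 0) # (\<lambda>ys. ys ! 1 - 1) # map (\<lambda>f ys. f (tl (tl ys))) fs'"
    have "recursive_in A (Suc (Suc n)) (\<lambda>ys. option_code (?e q (tl (tl ys)) (map (\<lambda>f. f ys) ?gs)))"
    proof (rule PrimRec.IH(2)[OF PrimRec.prems(1-3)[THEN recursive_in_tl2]])
      show "recursive_in A (Suc (Suc n)) h" if "h \<in> set ?gs" for h
        using that by (auto intro!: rec_intros recursive_in_tl2[OF fs'])
    qed
    \<comment> \<open>The value 0 codes divergence of the previous round of the recursion, and a
      code \<open>r > 0\<close> stands for the value \<open>r - 1\<close>.\<close>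
    then have "recursive_in A (Suc (Suc n)) (\<lambda>ys. if ys ! 1 = 0 then 0 else
        option_code (?e q (tl (tl ys)) (map (\<lambda>f. f ys) ?gs)))"
      by (intro recursive_in_if decidable_in_eq recursive_in_const recursive_in_proj) simp_all
    then have "recursive_in A (Suc (Suc n)) (\<lambda>ys. if ys ! 1 = 0 then 0 else
        option_code (?e q (tl (tl ys)) (ys ! 0 # (ys ! 1 - 1) # map (\<lambda>f. f (tl (tl ys))) fs')))"
      by (simp only: list.map map_map comp_def)
    from recursive_in_rec_nat[OF f PrimRec.IH(1)[OF PrimRec.prems(1-3) fs'], where h = "\<lambda>k r xs.
        if r = 0 then 0 else option_code (?e q xs (k # (r - 1) # map (\<lambda>f. f xs) fs'))", OF _ this]
    have "recursive_in A n (\<lambda>xs. rec_nat (option_code (?e p xs (map (\<lambda>f. f xs) fs')))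
        (\<lambda>k r. if r = 0 then 0 else option_code (?e q xs (k # (r - 1) # map (\<lambda>f. f xs) fs'))) (f xs))"
      by simp
    then show ?thesis
    proof (rule recursive_in_cong)
      fix xs
      have "rec_nat (option_code (?e p xs zs))
          (\<lambda>k r. if r = 0 then 0 else option_code (?e q xs (k # (r - 1) # zs))) m
        = option_code (?e (PrimRec p q) xs (m # zs))" for m zs
        by (induction m) (auto split: bind_split)
      then show "rec_nat (option_code (?e p xs (map (\<lambda>f. f xs) fs')))
          (\<lambda>k r. if r = 0 then 0 else option_code (?e q xs (k # (r - 1) # map (\<lambda>f. f xs) fs'))) (f xs)
        = option_code (?e (PrimRec p q) xs (map (\<lambda>f. f xs) fs))"
        by (simp add: Cons)
    qed
  qed (simp, intro rec_intros)
next
  case (Mu p)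
  let ?e = "\<lambda>xs m. option_code (eval_upto (s xs) (B (a xs) (b xs)) p (m # map (\<lambda>f. f xs) fs))"
  have e: "recursive_in A (Suc n) (\<lambda>ys. ?e (tl ys) (ys ! 0))"
  proof -
    let ?gs = "(\<lambda>ys. ys ! 0) # map (\<lambda>f ys. f (tl ys)) fs"
    have "recursive_in A (Suc n) (\<lambda>ys. option_code (eval_upto (s (tl ys)) (B (a (tl ys)) (b (tl ys))) p
        (map (\<lambda>f. f ys) ?gs)))"
    proof (rule Mu.IH[OF Mu.prems(1-3)[THEN recursive_in_tl]])
      show "recursive_in A (Suc n) h" if "h \<in> set ?gs" for h
        using that by (auto intro!: recursive_in_proj recursive_in_tl[OF Mu.prems(4)])
    qed
    then show ?thesis by (simp add: comp_def)
  qed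
  have e2: "recursive_in A (Suc (Suc n)) (\<lambda>ys. ?e (tl (tl ys)) (ys ! 0))"
  proof -
    let ?gs = "(\<lambda>ys. ys ! 0) # map (\<lambda>f ys. f (tl (tl ys))) fs"
    have "recursive_in A (Suc (Suc n)) (\<lambda>ys. option_code (eval_upto (s (tl (tl ys)))
        (B (a (tl (tl ys))) (b (tl (tl ys)))) p (map (\<lambda>f. f ys) ?gs)))"
    proof (rule Mu.IH[OF Mu.prems(1-3)[THEN recursive_in_tl2]])
      show "recursive_in A (Suc (Suc n)) h" if "h \<in> set ?gs" for h
        using that by (auto intro!: recursive_in_proj recursive_in_tl2[OF Mu.prems(4)])
    qed
    then show ?thesis by (simp add: comp_def)
  qed
  define z where "z xs = (LEAST z. s xs \<le> z \<or> ?e xs z = 1 \<and> (\<forall>m<z. ?e xs m \<noteq> 0))" for xs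
  have z: "recursive_in A n z"
    unfolding z_def
  proof (rule recursive_in_Least)
    show "decidable_in A (Suc n) (\<lambda>ys. s (tl ys) \<le> ys ! 0 \<or>
        ?e (tl ys) (ys ! 0) = 1 \<and> (\<forall>m<ys ! 0. ?e (tl ys) m \<noteq> 0))"
    proof (intro decidable_in_disj decidable_in_conj decidable_in_le decidable_in_eq
        recursive_in_const recursive_in_proj e recursive_in_tl[OF Mu.prems(1)])
      have "decidable_in A (Suc (Suc n)) (\<lambda>ys. ?e (tl (tl ys)) (ys ! 0) \<noteq> 0)"
        by (intro decidable_in_not decidable_in_eq e2 recursive_in_const)
      then show "decidable_in A (Suc n) (\<lambda>ys. \<forall>m<ys ! 0. ?e (tl ys) m \<noteq> 0)"
        by (intro decidable_in_ball recursive_in_proj) simp_all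
    qed simp_all
    show "\<exists>z. s xs \<le> z \<or> ?e xs z = 1 \<and> (\<forall>m<z. ?e xs m \<noteq> 0)" for xs
      by blast
  qed
  have "recursive_in A n (\<lambda>xs. if z xs < s xs then Suc (z xs) else 0)"
    by (intro recursive_in_if decidable_in_less recursive_in_Suc recursive_in_const z Mu.prems(1))
  then show ?case
    by (rule recursive_in_cong) (simp add: eval_upto.simps(7) Let_def z_def)
qed

text \<open>A program that is correct for the empty oracle may still query it and go wrong with
  oracle \<open>A\<close>. It is therefore simulated: search for a stage at which its bounded
  evaluation with the constant oracle \<open>{}\<close> converges, and return that value.\<close>

lemma recursive_in_if_recursive:
  assumes "recursive_in {} n f"
  shows "recursive_in A n f"
proof -
  from assms obtain p where p: "\<And>xs. length xs = n \<Longrightarrow> eval {} p xs = Some (f xs)"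
    unfolding recursive_in_def by blast
  define e where "e s xs = option_code (eval_upto s {} p xs)" for s and xs :: "nat list"
  have e: "recursive_in A m (\<lambda>ys. e (s ys) (map (\<lambda>i. ys ! i) is))"
    if "recursive_in A m s" "set is \<subseteq> {..<m}" for m s "is"
  proof -
    have "recursive_in A m (\<lambda>ys. option_code (eval_upto (s ys) ((\<lambda>_ _. {}) 0 0) p
        (map (\<lambda>f. f ys) (map (\<lambda>i ys. ys ! i) is))))"
      by (rule recursive_in_eval_upto) (use that in \<open>auto intro!: rec_intros\<close>)
    then show ?thesis by (simp add: e_def comp_def)
  qed
  have ex: "\<exists>s. e s xs \<noteq> 0" and val: "e s xs \<noteq> 0 \<Longrightarrow> e s xs - 1 = f xs" if "length xs = n" for xs s
    using p[OF that] eval_if_eval_upto[of s "{}" p xs] eval_iff_eval_upto[of "{}" p xs "f xs"]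
    by (auto simp: e_def)
  have "recursive_in A (Suc n) (\<lambda>ys. e (ys ! 0) (tl ys))"
    by (rule recursive_in_cong[OF e[of "Suc n" "\<lambda>ys. ys ! 0" "map Suc [0..<n]"]])
      (auto intro!: rec_intros arg_cong[where f = "e _"] nth_equalityI simp: nth_tl simp del: upt_Suc)
  then have L: "recursive_in A n (\<lambda>xs. LEAST s. e s xs \<noteq> 0)"
    by (intro rec_intros ex) simp_all
  have "recursive_in A n (\<lambda>xs. e (LEAST s. e s xs \<noteq> 0) (map (\<lambda>i. xs ! i) [0..<n]) - 1)"
    by (intro rec_intros e L) auto
  then show ?thesis
  proof (rule recursive_in_cong)
    fix xs :: "nat list" assume "length xs = n"
    then show "e (LEAST s. e s xs \<noteq> 0) (map (\<lambda>i. xs ! i) [0..<n]) - 1 = f xs"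
      using val[OF \<open>length xs = n\<close> LeastI_ex[OF ex]] map_nth[of xs] by simp
  qed
qed

section \<open>Questions to the jump\<close>

primrec const_prog :: "nat \<Rightarrow> prog" where
  "const_prog 0 = Zero"
| "const_prog (Suc c) = Comp Succ [const_prog c]"

lemma eval_const_prog: "eval A (const_prog c) xs = Some c"
  by (induction c) (simp_all add: eval.simps(5))

lemma recursive_in_list_encode:
  assumes "\<And>f. f \<in> set fs \<Longrightarrow> recursive_in A n f"
  shows "recursive_in A n (\<lambda>xs. list_encode (map (\<lambda>f. f xs) fs))"
  using assms
proof (induction fs)
  case (Cons f fs)
  then have "recursive_in A n (\<lambda>xs. Suc (prod_encode (f xs, list_encode (map (\<lambda>f. f xs) fs))))"
    by (intro rec_intros) simp_all
  then show ?case by simp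
qed (simp, intro rec_intros)

text \<open>An instance of the s-m-n theorem: inputs can be built into a program effectively, so a
  machine can compute the code about which it asks the jump.\<close>

lemma recursive_in_prog_code_const_prog:
  assumes "recursive_in A n f"
  shows "recursive_in A n (\<lambda>xs. prog_code (const_prog (f xs)))"
proof -
  have "prog_code (const_prog c) = rec_nat (prog_code Zero) 
    (\<lambda>_ r. prod_encode (4, prod_encode (prog_code Succ, Suc (prod_encode (r, 0))))) c" for c
    by (induction c) simp_all
  moreover have "recursive_in A n (\<lambda>xs. rec_nat (prog_code Zero) 
    (\<lambda>_ r. prod_encode (4, prod_encode (prog_code Succ, Suc (prod_encode (r, 0))))) (f xs))"
    by (intro recursive_in_rec_nat assms rec_intros) simp
  ultimately show ?thesis by simp
qed

text \<open>The diagonal input of the jump is discarded by composing with constant programs.\<close>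

lemma decidable_in_turing_jump_ex:
  assumes "decidable_in {} (Suc n) (\<lambda>ys. P (ys ! 0) (tl ys))"
  shows "decidable_in (turing_jump {}) n (\<lambda>xs. \<exists>z. P z xs)"
proof -
  from decidable_in_not[OF assms] obtain p where
    p: "\<And>ys. length ys = Suc n \<Longrightarrow> eval {} p ys = Some (of_bool (\<not> P (ys ! 0) (tl ys)))"
    unfolding recursive_in_def by blast
  have p': "eval {} (Mu p) xs \<noteq> None \<longleftrightarrow> (\<exists>z. P z xs)" if "length xs = n" for xs
    using that by (auto simp: p)
  define code where
    "code xs = prog_code (Comp (Mu p) (map const_prog xs))" for xs
  let ?A = "turing_jump {}"
  have "recursive_in ?A n (\<lambda>xs. prod_encode (4, prod_encode (prog_code (Mu p),
      list_encode (map (\<lambda>f. f xs) (map (\<lambda>i xs. prog_code (const_prog (xs ! i))) [0..<n])))))"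
    by (intro rec_intros recursive_in_list_encode) (auto intro!: recursive_in_prog_code_const_prog rec_intros)
  then have "recursive_in ?A n code"
  proof (rule recursive_in_cong)
    fix xs :: "nat list" assume "length xs = n"
    then have "map (\<lambda>i. prog_code (const_prog (xs ! i))) [0..<n] = map (\<lambda>c. prog_code (const_prog c)) xs"
      by (metis (no_types, lifting) map_eq_conv map_map map_nth comp_apply)
    then show "prod_encode (4, prod_encode (prog_code (Mu p),
      list_encode (map (\<lambda>f. f xs) (map (\<lambda>i xs. prog_code (const_prog (xs ! i))) [0..<n])))) = code xs"
      by (simp add: code_def comp_def)
  qed
  then have "decidable_in ?A n (\<lambda>xs. code xs \<in> ?A)"
    by (rule decidable_in_oracle)
  then show ?thesis
  proof (rule recursive_in_cong)
    fix xs :: "nat list" assume xs: "length xs = n"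
    have "eval {} (Comp (Mu p) (map const_prog xs)) ys = eval {} (Mu p) xs" for ys
      by (rule eval_Comp_total) (simp_all add: eval_const_prog)
    then have "code xs \<in> ?A \<longleftrightarrow> eval {} (Mu p) xs \<noteq> None"
      unfolding turing_jump_def code_def mem_Collect_eq by (metis injD[OF inj_prog_code])
    then show "of_bool (code xs \<in> ?A) = of_bool (\<exists>z. P z xs)"
      using p'[OF xs] by simp
  qed
qed

section \<open>Martin-Loef tests given by levels\<close>

text \<open>Such a \<open>P\<close> is a clopen event, a union of cylinders of length
  \<open>s\<close>.\<close>

definition determined_below :: "nat \<Rightarrow> (nat set \<Rightarrow> bool) \<Rightarrow> bool" where
  "determined_below s P \<longleftrightarrow> (\<forall>Y. P (Y \<inter> {..<s}) \<longleftrightarrow> P Y)"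

lemma determined_belowI: "(\<And>Y. P (Y \<inter> {..<s}) \<longleftrightarrow> P Y) \<Longrightarrow> determined_below s P"
  and determined_belowD: "determined_below s P \<Longrightarrow> P (Y \<inter> {..<s}) \<longleftrightarrow> P Y"
  by (simp_all add: determined_below_def)

lemma determined_below_cong:
  "determined_below s P \<Longrightarrow> Y \<inter> {..<s} = Z \<inter> {..<s} \<Longrightarrow> P Y \<longleftrightarrow> P Z"
  unfolding determined_below_def by metis

lemma determined_below_mono:
  assumes "determined_below s P" "s \<le> t" shows "determined_below t P"
proof (rule determined_belowI)
  fix Y
  have "Y \<inter> {..<t} \<inter> {..<s} = Y \<inter> {..<s}"
    using assms(2) by auto
  then show "P (Y \<inter> {..<t}) \<longleftrightarrow> P Y"
    by (rule determined_below_cong[OF assms(1)])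
qed

text \<open>The numbers below \<open>2 ^ s\<close> list all possible initial segments of length
  \<open>s\<close>, so the probability of a clopen event becomes a computable finite sum.\<close>

lemma bij_betw_set_decode: "bij_betw set_decode {..<2 ^ s} (Pow {..<s})"
proof (rule bij_betw_byWitness[where f' = set_encode])
  show "set_decode ` {..<2 ^ s} \<subseteq> Pow {..<s}"
  proof safe
    fix x i :: nat
    assume x: "x < 2 ^ s" and i: "i \<in> set_decode x"
    show "i < s"
    proof (rule ccontr)
      assume "\<not> i < s"
      then have "(2 :: nat) ^ s \<le> 2 ^ i"
        by simp
      with x have "x < 2 ^ i"
        by (rule order_less_le_trans)
      with i show False
        by (simp add: set_decode_def div_less)
    qed
  qed
  show "set_encode ` Pow {..<s} \<subseteq> {..<2 ^ s}"
  proof safe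
    fix F assume "F \<subseteq> {..<s}"
    then have "set_encode F \<le> (\<Sum>i<s. 2 ^ i)"
      unfolding set_encode_def using finite_subset by (auto intro: sum_mono2)
    also have "\<dots> < 2 ^ s"
      by (induction s) auto
    finally show "set_encode F < 2 ^ s" .
  qed
qed (auto simp: finite_subset[OF _ finite_lessThan])

abbreviation cantor_prob :: "(nat set \<Rightarrow> bool) \<Rightarrow> real" where
  "cantor_prob P \<equiv> measure cantor_measure {y. P {i. y i}}"

lemma prob_space_cantor_measure: "prob_space cantor_measure"
  unfolding cantor_measure_def by (intro prob_space_PiM measure_pmf.prob_space_axioms)

interpretation cantor: prob_space cantor_measure
  by (rule prob_space_cantor_measure)

lemma cantor_basic:
  shows "{y. {i. y i} \<inter> {..<s} = F \<inter> {..<s}} \<in> sets cantor_measure"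
    and "measure cantor_measure {y. {i. y i} \<inter> {..<s} = F \<inter> {..<s}} = (1 / 2) ^ s"
proof -
  let ?M = "\<lambda>_ :: nat. measure_pmf (bernoulli_pmf (1 / 2))"
  have eq: "{y. {i. y i} \<inter> {..<s} = F \<inter> {..<s}}
      = prod_emb UNIV ?M {..<s} (Pi\<^sub>E {..<s} (\<lambda>i. {i \<in> F}))"
  proof (rule set_eqI)
    fix y :: "nat \<Rightarrow> bool"
    have "{i. y i} \<inter> {..<s} = F \<inter> {..<s} \<longleftrightarrow> (\<forall>i\<in>{..<s}. y i = (i \<in> F))"
      by blast
    also have "\<dots> \<longleftrightarrow> restrict y {..<s} \<in> Pi\<^sub>E {..<s} (\<lambda>i. {i \<in> F})"
      unfolding restrict_PiE_iff by simp
    finally show "y \<in> {y. {i. y i} \<inter> {..<s} = F \<inter> {..<s}} \<longleftrightarrow>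
        y \<in> prod_emb UNIV ?M {..<s} (Pi\<^sub>E {..<s} (\<lambda>i. {i \<in> F}))"
      by (simp only: prod_emb_iff mem_Collect_eq space_measure_pmf UNIV_I extensional_UNIV) simp
  qed
  show "{y. {i. y i} \<inter> {..<s} = F \<inter> {..<s}} \<in> sets cantor_measure"
    unfolding cantor_measure_def eq by (rule sets_PiM_I) auto
  have "emeasure (PiM UNIV ?M) (prod_emb UNIV ?M {..<s} (Pi\<^sub>E {..<s} (\<lambda>i. {i \<in> F})))
      = (\<Prod>i<s. emeasure (measure_pmf (bernoulli_pmf (1 / 2))) {i \<in> F})"
    by (rule emeasure_PiM_emb) (simp_all add: measure_pmf.prob_space_axioms)
  also have "\<dots> = (\<Prod>i<s. ennreal (1 / 2))"
    by (rule prod.cong) (auto simp: emeasure_pmf_single)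
  also have "\<dots> = ennreal ((1 / 2) ^ s)"
    by (simp only: prod_constant card_lessThan) (rule ennreal_power, simp)
  finally show "measure cantor_measure {y. {i. y i} \<inter> {..<s} = F \<inter> {..<s}} = (1 / 2) ^ s"
    unfolding cantor_measure_def eq by (simp add: measure_def)
qed

lemma
  assumes "determined_below s P"
  shows cantor_measurable: "{y. P {i. y i}} \<in> sets cantor_measure"
    and cantor_prob_eq_card: "cantor_prob P = card {Y. Y \<subseteq> {..<s} \<and> P Y} / 2 ^ s"
proof -
  let ?F = "{Y. Y \<subseteq> {..<s} \<and> P Y}"
  let ?C = "\<lambda>F. {y. {i. y i} \<inter> {..<s} = F \<inter> {..<s}}"
  have eq: "{y. P {i. y i}} = (\<Union>F\<in>?F. ?C F)"
  proof safe
    fix y assume "P {i. y i}"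
    then have "{i. y i} \<inter> {..<s} \<in> ?F"
      using determined_belowD[OF assms] by auto
    moreover have "y \<in> ?C ({i. y i} \<inter> {..<s})"
      by auto
    ultimately show "y \<in> (\<Union>F\<in>?F. ?C F)"
      by (rule UN_I)
  next
    fix y F assume "P F" "{i. y i} \<inter> {..<s} = F \<inter> {..<s}"
    then show "P {i. y i}"
      using determined_below_cong[OF assms] by blast
  qed
  have fin: "finite ?F"
    by simp
  show "{y. P {i. y i}} \<in> sets cantor_measure"
    unfolding eq by (rule sets.finite_UN[OF fin]) (rule cantor_basic(1))
  have "measure cantor_measure (\<Union>F\<in>?F. ?C F) = (\<Sum>F\<in>?F. measure cantor_measure (?C F))"
  proof (rule cantor.finite_measure_finite_Union[OF fin])
    show "(\<lambda>F. ?C F) ` ?F \<subseteq> sets cantor_measure"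
      by (rule image_subsetI) (rule cantor_basic(1))
    show "disjoint_family_on ?C ?F"
      unfolding disjoint_family_on_def
    proof (intro ballI impI)
      fix F G assume "F \<in> ?F" "G \<in> ?F" "F \<noteq> G"
      then have "F \<inter> {..<s} \<noteq> G \<inter> {..<s}"
        by (simp add: Int_absorb2)
      then show "?C F \<inter> ?C G = {}"
        by (intro equals0I) (simp only: Int_iff mem_Collect_eq, metis)
    qed
  qed
  also have "\<dots> = (\<Sum>F\<in>?F. (1 / 2) ^ s)"
    by (rule sum.cong[OF refl]) (rule cantor_basic(2))
  also have "\<dots> = card ?F / 2 ^ s"
    by (simp add: power_divide)
  finally show "cantor_prob P = card ?F / 2 ^ s"
    by (simp only: eq)
qed

lemma list_encode_drop:
  "rec_nat (list_encode xs) (\<lambda>_ r. snd (prod_decode (r - 1))) i = list_encode (drop i xs)"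
proof (induction i)
  case (Suc i)
  \<comment> \<open>The empty list has code 0, and taking the tail of this code gives
    \<open>prod_decode (0 - 1) = prod_decode 0\<close>, so 0 is a fixed point.\<close>
  have 0: "prod_decode 0 = (0, 0)"
    using prod_decode_triangle_add[of 0 0] by (simp add: prod_decode_aux.simps)
  show ?case
  proof (cases "drop i xs")
    case Nil
    then have "drop (Suc i) xs = []"
      by (simp add: drop_eq_Nil)
    with Nil Suc show ?thesis by (simp add: 0)
  next
    case (Cons a ys)
    then have "drop (Suc i) xs = ys"
      by (metis drop_Suc list.sel(3) tl_drop)
    with Cons Suc show ?thesis by simp
  qed
qed simp

text \<open>Tests enumerate strings through \<open>string_code\<close>, while finite oracles are
  coded through \<open>set_decode\<close>. These two functions translate from the first coding to
  the second.\<close>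

lemma recursive_string_code:
  "\<exists>len num. recursive_in A 1 (\<lambda>xs. len (xs ! 0)) \<and> recursive_in A 1 (\<lambda>xs. num (xs ! 0)) \<and>
    (\<forall>\<sigma>. len (string_code \<sigma>) = length \<sigma> \<and>
      set_decode (num (string_code \<sigma>)) = {i. i < length \<sigma> \<and> \<sigma> ! i})"
proof -
  define tail where "tail c i = rec_nat c (\<lambda>_ r. snd (prod_decode (r - 1))) i" for c i
  have tail: "recursive_in A n (\<lambda>xs. tail (f xs) (g xs))"
    if "recursive_in A n f" "recursive_in A n g" for n f g
    unfolding tail_def by (intro recursive_in_rec_nat that rec_intros) simp
  have tail_eq: "tail (list_encode xs) i = list_encode (drop i xs)" for xs i
    unfolding tail_def by (rule list_encode_drop)
  define len where "len c = (LEAST i. tail c i = 0)" for c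
  define num where "num c = (\<Sum>i<len c. fst (prod_decode (tail c i - 1)) * 2 ^ i)" for c
  have ex: "\<exists>i. tail c i = 0" for c
    using tail_eq[of "list_decode c" "length (list_decode c)"] by auto
  have len: "recursive_in A n (\<lambda>xs. len (f xs))" if "recursive_in A n f" for n f
    unfolding len_def by (intro recursive_in_Least tail rec_intros recursive_in_tl[OF that] ex) simp
  have num: "recursive_in A 1 (\<lambda>xs. num (xs ! 0))"
    unfolding num_def by (intro rec_intros len tail) simp_all
  have eq_0: "list_encode xs = 0 \<longleftrightarrow> xs = []" for xs
    by (cases xs) auto
  have len_eq: "len (string_code \<sigma>) = length \<sigma>" for \<sigma>
    unfolding len_def string_code_def tail_eq eq_0 by (rule Least_equality) auto
  have "num (string_code \<sigma>) = set_encode {i. i < length \<sigma> \<and> \<sigma> ! i}" for \<sigma>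
  proof -
    have "fst (prod_decode (tail (string_code \<sigma>) i - 1)) = of_bool (\<sigma> ! i)" if "i < length \<sigma>" for i
      unfolding string_code_def tail_eq using that by (simp add: drop_map Cons_nth_drop_Suc[symmetric])
    then have "num (string_code \<sigma>) = (\<Sum>i<length \<sigma>. of_bool (\<sigma> ! i) * 2 ^ i)"
      unfolding num_def len_eq by (intro sum.cong) auto
    also have "\<dots> = (\<Sum>i\<in>{i. i < length \<sigma> \<and> \<sigma> ! i}. 2 ^ i)"
      by (rule sum.mono_neutral_cong_right) auto
    finally show ?thesis by (simp add: set_encode_def)
  qed
  then have "set_decode (num (string_code \<sigma>)) = {i. i < length \<sigma> \<and> \<sigma> ! i}" for \<sigma>
    by simp
  moreover have "recursive_in A 1 (\<lambda>xs. len (xs ! 0))"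
    by (intro len recursive_in_proj) simp
  ultimately show ?thesis
    using num len_eq by blast
qed

text \<open>Enumerating those \<open>\<sigma>\<close> that satisfy \<open>P k\<close> at stage
  \<open>length \<sigma>\<close> generates the union over \<open>s\<close> of the clopen events
  \<open>P k s\<close>. The union is increasing, so a bound on each stage bounds its measure, and
  the classes form a test relative to \<open>A\<close>.\<close>

lemma martin_loef_random_avoids:
  assumes random: "martin_loef_random A X"
    and dec: "decidable_in A 3 (\<lambda>xs. P (xs ! 0) (xs ! 1) (set_decode (xs ! 2)))"
    and det: "\<And>k s. determined_below s (P k s)"
    and mono: "\<And>k s t Y. P k s Y \<Longrightarrow> s \<le> t \<Longrightarrow> P k t Y"
    and prob: "\<And>k s. cantor_prob (P k s) \<le> (1 / 2) ^ k"
  shows "\<exists>k. \<forall>s. \<not> P k s X"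
proof -
  obtain len num where len: "recursive_in A 1 (\<lambda>xs. len (xs ! 0))"
    and num: "recursive_in A 1 (\<lambda>xs. num (xs ! 0))"
    and len_eq: "\<And>\<sigma>. len (string_code \<sigma>) = length \<sigma>"
    and num_eq: "\<And>\<sigma>. set_decode (num (string_code \<sigma>)) = {i. i < length \<sigma> \<and> \<sigma> ! i}"
    using recursive_string_code[of A] by blast
  have "recursive_in A 2 (\<lambda>xs. len (xs ! 1))" "recursive_in A 2 (\<lambda>xs. num (xs ! 1))"
    by (intro recursive_in_subst1[where g = len, OF len] recursive_in_subst1[where g = num, OF num]
        recursive_in_proj; simp)+
  moreover have "recursive_in A 2 (\<lambda>xs. xs ! 0)"
    by (intro recursive_in_proj) simp
  ultimately have "decidable_in A 2 (\<lambda>xs. P (xs ! 0) (len (xs ! 1)) (set_decode (num (xs ! 1))))"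
    using recursive_in_subst3[where g = "\<lambda>k s x. of_bool (P k s (set_decode x))", OF dec] by blast
  then obtain p where
    p: "\<And>xs. length xs = 2 \<Longrightarrow> eval A p xs \<noteq> None \<longleftrightarrow> P (xs ! 0) (len (xs ! 1)) (set_decode (num (xs ! 1)))"
    by (rule semidecidable_if_decidable) blast
  have p: "eval A p [k, string_code \<sigma>] \<noteq> None \<longleftrightarrow> P k (length \<sigma>) {i. i < length \<sigma> \<and> \<sigma> ! i}" for k \<sigma>
    using p[of "[k, string_code \<sigma>]"] by (simp add: len_eq num_eq)
  have cyl: "{i. y i} \<inter> {..<length \<sigma>} = {i. i < length \<sigma> \<and> \<sigma> ! i} \<inter> {..<length \<sigma>}"
    if "y \<in> cylinder \<sigma>" for y \<sigma>
    using that by (auto simp: cylinder_def)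
  have open_eq: "effective_open A p k = (\<Union>s. {y. P k s {i. y i}})" for k
  proof safe
    fix y assume "y \<in> effective_open A p k"
    then obtain \<sigma> where "P k (length \<sigma>) {i. i < length \<sigma> \<and> \<sigma> ! i}" "y \<in> cylinder \<sigma>"
      unfolding effective_open_def p by blast
    then have "P k (length \<sigma>) {i. y i}"
      using determined_below_cong[OF det cyl] by blast
    then show "y \<in> (\<Union>s. {y. P k s {i. y i}})"
      by blast
  next
    fix y s assume *: "P k s {i. y i}"
    define \<sigma> where "\<sigma> = map y [0..<s]"
    have "y \<in> cylinder \<sigma>" "length \<sigma> = s"
      unfolding cylinder_def \<sigma>_def by auto
    moreover from this * have "P k s {i. i < length \<sigma> \<and> \<sigma> ! i}"
      using determined_below_cong[OF det cyl, of y \<sigma> k] by simp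
    ultimately show "y \<in> effective_open A p k"
      unfolding effective_open_def p by blast
  qed
  have "martin_loef_test A (effective_open A p)"
    unfolding martin_loef_test_def
  proof safe
    fix k
    have "(\<lambda>s. cantor_prob (P k s)) \<longlonglongrightarrow> measure cantor_measure (\<Union>s. {y. P k s {i. y i}})"
      by (rule cantor.finite_Lim_measure_incseq)
        (use cantor_measurable[OF det] mono in \<open>auto simp: incseq_def\<close>)
    then show "measure cantor_measure (effective_open A p k) \<le> (1 / 2) ^ k"
      unfolding open_eq by (rule LIMSEQ_le_const2) (use prob in auto)
  qed blast
  then have "(\<lambda>i. i \<in> X) \<notin> (\<Inter>k. effective_open A p k)"
    using random unfolding martin_loef_random_def by blast
  then show ?thesis
    unfolding open_eq by simp
qed

section \<open>Random sets do not guess their own bits\<close>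

text \<open>\<open>h s n Y\<close> is a guess at the bit \<open>n\<close> of \<open>Y\<close> made at stage \<open>s\<close>: \<open>0\<close> means no guess yet, and
  \<open>Suc b\<close> the guess \<open>b\<close>. The bit being guessed is \<open>guess_pos\<close>; after a correct guess at stage \<open>s\<close>
  it moves to \<open>s\<close>, which lies above everything inspected so far, and after a wrong guess it is
  stuck.\<close>

context
  fixes h :: "nat \<Rightarrow> nat \<Rightarrow> nat set \<Rightarrow> nat"
begin

primrec guess_pos :: "nat set \<Rightarrow> nat \<Rightarrow> nat" where
  "guess_pos Y 0 = 0"
| "guess_pos Y (Suc t) =
     (if h (Suc t) (guess_pos Y t) Y = Suc (of_bool (guess_pos Y t \<in> Y)) then Suc t else guess_pos Y t)"

text \<open>The number of correct guesses before stage \<open>Suc s\<close>. The position never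
  exceeds the current stage, so it equals \<open>Suc t\<close> at stage \<open>Suc t\<close> only by
  a move there.\<close>

definition guess_count :: "nat set \<Rightarrow> nat \<Rightarrow> nat" where
  "guess_count Y s = (\<Sum>t<s. of_bool (guess_pos Y (Suc t) = Suc t))"

lemma guess_pos_le: "guess_pos Y t \<le> t"
  by (induction t) auto

lemma guess_pos_Suc_eq_iff:
  "guess_pos Y (Suc t) = Suc t \<longleftrightarrow> h (Suc t) (guess_pos Y t) Y = Suc (of_bool (guess_pos Y t \<in> Y))"
  using guess_pos_le[of Y t] by auto

lemma guess_pos_Suc_cases: "guess_pos Y (Suc t) = Suc t \<or> guess_pos Y (Suc t) = guess_pos Y t"
  by simp

lemma guess_count_Suc:
  "guess_count Y (Suc t) = guess_count Y t + of_bool (guess_pos Y (Suc t) = Suc t)"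
  by (simp add: guess_count_def)

lemma guess_count_mono: "s \<le> t \<Longrightarrow> guess_count Y s \<le> guess_count Y t"
  unfolding guess_count_def by (intro sum_mono2) auto

text \<open>A position is the stage at which it was reached. The history up to stage
  \<open>n\<close> thus already ends in position \<open>n\<close>, and it involves only bits below
  \<open>n\<close>.\<close>

lemma guess_pos_idem: "guess_pos Y (guess_pos Y t) = guess_pos Y t"
  by (induction t) (simp_all split: if_splits)

lemma guess_const:
  assumes "s \<le> t" "\<And>r. s \<le> r \<Longrightarrow> r < t \<Longrightarrow> h (Suc r) (guess_pos Y s) Y \<noteq> Suc (of_bool (guess_pos Y s \<in> Y))"
  shows "guess_pos Y t = guess_pos Y s \<and> guess_count Y t = guess_count Y s"
  using assms
proof (induction t rule: dec_induct)
  case (step t)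
  then have IH: "guess_pos Y t = guess_pos Y s" "guess_count Y t = guess_count Y s"
    by simp_all
  have "h (Suc t) (guess_pos Y t) Y \<noteq> Suc (of_bool (guess_pos Y t \<in> Y))"
    using step.prems[of t] step.hyps IH by simp
  then show ?case
    using IH guess_count_Suc[of Y t] guess_pos_le[of Y t] by simp
qed simp

text \<open>Every correct guess moves the position strictly upwards, so between equal positions
  there was none.\<close>

lemma guess_count_eq_if_guess_pos_eq:
  assumes "s \<le> t" "guess_pos Y s = guess_pos Y t"
  shows "guess_count Y s = guess_count Y t"
  using assms
proof (induction t rule: dec_induct)
  case (step t)
  have no_jump: "guess_pos Y (Suc t) \<noteq> Suc t"
    using guess_pos_le[of Y s] step.prems step.hyps by linarith
  then have "guess_pos Y (Suc t) = guess_pos Y t"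
    using guess_pos_Suc_cases by blast
  then have "guess_count Y s = guess_count Y t"
    using step.IH step.prems by simp
  with no_jump show ?case
    by (simp add: guess_count_Suc del: guess_pos.simps)
qed simp

text \<open>\<open>h_local\<close> makes events about guesses clopen and shields the history up to
  stage \<open>n\<close> from a change of bit \<open>n\<close>; \<open>h_self\<close> gives two sets
  that differ only at \<open>n\<close> the same guess at \<open>n\<close>; \<open>h_mono\<close>
  makes a guess final, so that a wrong one blocks all progress.\<close>

context
  assumes h_local: "\<And>s n Y. h s n (Y \<inter> {..<s}) = h s n Y"
    and h_self: "\<And>s n Y. h s n (Y - {n}) = h s n Y"
    and h_mono: "\<And>s t n Y. h s n Y \<noteq> 0 \<Longrightarrow> s \<le> t \<Longrightarrow> h t n Y = h s n Y"
begin

lemma h_local_cong: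
  assumes "Y \<inter> {..<s} = Z \<inter> {..<s}" shows "h s n Y = h s n Z"
  unfolding h_local[of s n Y, symmetric] h_local[of s n Z, symmetric] assms ..

lemma guess_local:
  assumes "Y \<inter> {..<s} = Z \<inter> {..<s}" "t \<le> s"
  shows "guess_pos Y t = guess_pos Z t \<and> guess_count Y t = guess_count Z t"
  using assms(2)
proof (induction t)
  case (Suc t)
  have "Y \<inter> {..<Suc t} = Y \<inter> {..<s} \<inter> {..<Suc t}" "Z \<inter> {..<Suc t} = Z \<inter> {..<s} \<inter> {..<Suc t}"
    using Suc.prems by auto
  with assms(1) have "Y \<inter> {..<Suc t} = Z \<inter> {..<Suc t}"
    by simp
  then have "h (Suc t) n Y = h (Suc t) n Z" for n
    by (rule h_local_cong)
  moreover have "guess_pos Y t \<in> Y \<longleftrightarrow> guess_pos Y t \<in> Z"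
  proof -
    have "guess_pos Y t \<in> {..<s}"
      using guess_pos_le[of Y t] Suc.prems by simp
    with assms(1) show ?thesis by blast
  qed
  ultimately show ?case
    using Suc by (simp add: guess_count_Suc)
qed (simp add: guess_count_def)

text \<open>Flipping the bit at the current position turns the next correct guess into a wrong one,
  after which the position never moves again. This is the injection behind the bound by one half.\<close>

lemma guess_flip:
  assumes "k < guess_count Y s"
  shows "\<exists>n<s. guess_count (sym_diff Y {n}) s = k \<and> guess_pos (sym_diff Y {n}) s = n"
proof -
  \<comment> \<open>Stage \<open>Suc t\<close> is the one of the correct guess that raises the count
    from \<open>k\<close> to \<open>k + 1\<close>; the bit guessed there will be flipped.\<close>
  define t where "t = (LEAST t. k < guess_count Y (Suc t))"
  have "s \<noteq> 0"
  proof
    assume "s = 0"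
    with assms show False by (simp add: guess_count_def)
  qed
  with assms have ex: "k < guess_count Y (Suc (s - 1))"
    by simp
  then have t: "k < guess_count Y (Suc t)"
    unfolding t_def by (rule LeastI)
  have "t \<le> s - 1"
    unfolding t_def using ex by (rule Least_le)
  with \<open>s \<noteq> 0\<close> have "t < s"
    by simp
  have "guess_count Y t \<le> k"
  proof (cases t)
    case (Suc r)
    then show ?thesis
      using not_less_Least[of r "\<lambda>t. k < guess_count Y (Suc t)"] unfolding t_def[symmetric] by simp
  qed (simp add: guess_count_def)
  with t have k: "guess_count Y t = k" and jump: "guess_pos Y (Suc t) = Suc t"
    unfolding guess_count_Suc by (simp_all add: of_bool_def del: guess_pos.simps split: if_splits)
  define n where "n = guess_pos Y t"
  let ?Z = "sym_diff Y {n}"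
  have "n \<le> t"
    unfolding n_def by (rule guess_pos_le)
  have hZ: "h r n ?Z = h r n Y" for r
  proof -
    have "?Z - {n} = Y - {n}"
      by blast
    then show ?thesis
      using h_self[of r n ?Z] h_self[of r n Y] by simp
  qed
  have nY: "guess_pos Y n = n"
    unfolding n_def by (rule guess_pos_idem)
  have "guess_count Y n = k"
    using guess_count_eq_if_guess_pos_eq[OF \<open>n \<le> t\<close>, of Y] nY n_def k by simp
  have right: "h (Suc t) n Y = Suc (of_bool (n \<in> Y))"
    using jump unfolding guess_pos_Suc_eq_iff n_def .
  have wrong: "h (Suc r) n Y \<noteq> Suc (of_bool (n \<in> ?Z))" if "n \<le> r" for r
  proof (cases "h (Suc r) n Y = 0")
    case False
    have "h (Suc r) n Y = h (Suc t) n Y"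
    proof (cases "r \<le> t")
      case True
      then show ?thesis using h_mono[OF False, of "Suc t"] by simp
    next
      case False
      then show ?thesis using h_mono[of "Suc t" n Y "Suc r"] right by simp
    qed
    moreover have "n \<in> ?Z \<longleftrightarrow> n \<notin> Y"
      by blast
    ultimately show ?thesis
      using right by simp
  qed simp
  have "guess_pos ?Z n = n" "guess_count ?Z n = k"
  proof -
    have "?Z \<inter> {..<n} = Y \<inter> {..<n}"
      by auto
    from guess_local[OF this order_refl] show "guess_pos ?Z n = n" "guess_count ?Z n = k"
      using nY \<open>guess_count Y n = k\<close> by simp_all
  qed
  moreover from this(1) have "guess_pos ?Z s = guess_pos ?Z n \<and> guess_count ?Z s = guess_count ?Z n"
    using \<open>n \<le> t\<close> \<open>t < s\<close> wrong by (intro guess_const) (simp_all only: hZ, simp_all)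
  ultimately show ?thesis
    using \<open>n \<le> t\<close> \<open>t < s\<close> by (intro exI[of _ n]) simp
qed

lemma card_guess_count:
  "card {Y. Y \<subseteq> {..<s} \<and> k \<le> guess_count Y s} * 2 ^ k \<le> 2 ^ s"
proof (induction k)
  case 0
  have "{Y. Y \<subseteq> {..<s} \<and> 0 \<le> guess_count Y s} = Pow {..<s}"
    by auto
  then show ?case by (simp add: card_Pow)
next
  case (Suc k)
  let ?S = "\<lambda>k. {Y. Y \<subseteq> {..<s} \<and> k \<le> guess_count Y s}"
  let ?T = "{Y. Y \<subseteq> {..<s} \<and> guess_count Y s = k}"
  have "\<forall>Y\<in>?S (Suc k). \<exists>n<s. guess_count (sym_diff Y {n}) s = k \<and> guess_pos (sym_diff Y {n}) s = n"
    using guess_flip by (simp add: Suc_le_eq)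
  then obtain n where n: "\<And>Y. Y \<in> ?S (Suc k) \<Longrightarrow> n Y < s \<and>
      guess_count (sym_diff Y {n Y}) s = k \<and> guess_pos (sym_diff Y {n Y}) s = n Y"
    by metis
  have "card (?S (Suc k)) \<le> card ?T"
  proof (rule card_inj_on_le)
    show "(\<lambda>Y. sym_diff Y {n Y}) ` ?S (Suc k) \<subseteq> ?T"
      using n by auto
    show "inj_on (\<lambda>Y. sym_diff Y {n Y}) (?S (Suc k))"
    \<comment> \<open>The flipped set is stuck at the flipped bit, so its final position tells which
      bit to flip back.\<close>
    proof (rule inj_on_inverseI[where g = "\<lambda>Z. sym_diff Z {guess_pos Z s}"])
      fix Y assume "Y \<in> ?S (Suc k)"
      then have "guess_pos (sym_diff Y {n Y}) s = n Y"
        using n by blast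
      then show "sym_diff (sym_diff Y {n Y}) {guess_pos (sym_diff Y {n Y}) s} = Y"
        by auto
    qed
  qed simp
  moreover have "card (?S k) = card (?S (Suc k)) + card ?T"
  proof -
    have "?S k = ?S (Suc k) \<union> ?T" "?S (Suc k) \<inter> ?T = {}"
      by auto
    then show ?thesis
      by (simp add: card_Un_disjoint)
  qed
  \<comment> \<open>Among the sets with at least \<open>k\<close> correct guesses, those with
    exactly \<open>k\<close> are at least as many as the others.\<close>
  ultimately have "card (?S (Suc k)) * 2 \<le> card (?S k)"
    by simp
  then have "card (?S (Suc k)) * 2 * 2 ^ k \<le> card (?S k) * 2 ^ k"
    by (rule mult_right_mono) simp
  also note Suc
  finally show ?case
    by (simp only: power_Suc mult.assoc)
qed

lemma guess_count_unbounded: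
  assumes "\<And>n. \<exists>s. h s n X = Suc (of_bool (n \<in> X))"
  shows "\<exists>s. k \<le> guess_count X s"
proof (induction k)
  case (Suc k)
  then obtain s where s: "k \<le> guess_count X s"
    by blast
  obtain r where r: "h r (guess_pos X s) X = Suc (of_bool (guess_pos X s \<in> X))"
    using assms[of "guess_pos X s"] by blast
  have "\<exists>t. guess_count X s < guess_count X t"
  proof (rule ccontr)
    assume "\<nexists>t. guess_count X s < guess_count X t"
    then have const: "guess_count X t = guess_count X s" if "s \<le> t" for t
      using guess_count_mono[OF that, of X] by (simp add: not_less order_antisym)
    have no_jump: "guess_pos X (Suc t) \<noteq> Suc t" if "s \<le> t" for t
      using guess_count_Suc[of X t] const[of t] const[of "Suc t"] that
      by (simp del: guess_pos.simps)
    have pos_const: "guess_pos X t = guess_pos X s" if "s \<le> t" for t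
      using that
    proof (induction t rule: dec_induct)
      case (step t)
      then show ?case
        using no_jump[of t] guess_pos_Suc_cases[of X t] by (simp del: guess_pos.simps)
    qed simp
    \<comment> \<open>The guess may have appeared before its bit became the current position. By
      \<open>h_mono\<close> it is still in force after both stages.\<close>
    have "guess_pos X (max r s) = guess_pos X s"
      by (rule pos_const) simp
    moreover have "h (Suc (max r s)) (guess_pos X s) X = h r (guess_pos X s) X"
      using r by (intro h_mono) simp_all
    ultimately have "guess_pos X (Suc (max r s)) = Suc (max r s)"
      unfolding guess_pos_Suc_eq_iff using r by simp
    with no_jump[of "max r s"] show False
      by (simp del: guess_pos.simps)
  qed
  then obtain t where "guess_count X s < guess_count X t"
    by blast
  with s have "Suc k \<le> guess_count X t"
    by simp
  then show ?case
    by blast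
qed simp

text \<open>Having made at least \<open>k\<close> correct guesses is an event of probability at most
  \<open>2 ^ -k\<close>. A set for which every bit is eventually guessed correctly lies in all these
  levels of a test.\<close>

lemma not_martin_loef_random_if_guessed:
  assumes "recursive_in A 3 (\<lambda>xs. h (xs ! 0) (xs ! 1) (set_decode (xs ! 2)))"
    and "\<And>n. \<exists>s. h s n X = Suc (of_bool (n \<in> X))"
  shows "\<not> martin_loef_random A X"
proof
  assume random: "martin_loef_random A X"
  have h: "recursive_in A n (\<lambda>xs. h (f xs) (g xs) (set_decode (e xs)))"
    if "recursive_in A n f" "recursive_in A n g" "recursive_in A n e" for n f g e
    using recursive_in_subst3[where g = "\<lambda>s n x. h s n (set_decode x)", OF assms(1) that] .
  define pos where "pos x t = rec_nat 0 (\<lambda>t r. if h (Suc t) r (set_decode x) = Suc (of_bool (r \<in> set_decode x))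
      then Suc t else r) t" for x t
  have pos_eq: "pos x t = guess_pos (set_decode x) t" for x t
    unfolding pos_def by (induction t) simp_all
  have pos: "recursive_in A n (\<lambda>xs. pos (f xs) (g xs))"
    if "recursive_in A n f" "recursive_in A n g" for n f g
    unfolding pos_def
    by (intro recursive_in_rec_nat that h recursive_in_if decidable_in_eq recursive_in_Suc
        decidable_in_set_decode recursive_in_proj recursive_in_const recursive_in_tl2[OF that(1)]) simp_all
  have "decidable_in A 3 (\<lambda>xs. xs ! 0 \<le> (\<Sum>t<xs ! 1. of_bool (pos (xs ! 2) (Suc t) = Suc t)))"
    by (intro rec_intros pos) simp_all
  then have dec: "decidable_in A 3 (\<lambda>xs. xs ! 0 \<le> guess_count (set_decode (xs ! 2)) (xs ! 1))"
    unfolding guess_count_def pos_eq .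
  have det: "determined_below s (\<lambda>Y. k \<le> guess_count Y s)" for k s
    using guess_local[of "_ \<inter> {..<s}" s _ s] by (intro determined_belowI) (simp add: Int_assoc)
  have "\<exists>k. \<forall>s. \<not> k \<le> guess_count X s"
  proof (rule martin_loef_random_avoids[OF random, where P = "\<lambda>k s Y. k \<le> guess_count Y s"])
    show "cantor_prob (\<lambda>Y. k \<le> guess_count Y s) \<le> (1 / 2) ^ k" for k s
    proof -
      have "real (card {Y. Y \<subseteq> {..<s} \<and> k \<le> guess_count Y s} * 2 ^ k) \<le> real (2 ^ s)"
        using card_guess_count[of s k] by (simp only: of_nat_le_iff)
      then show ?thesis
        unfolding cantor_prob_eq_card[OF det] by (simp add: field_simps)
    qed
    show "k \<le> guess_count Y t" if "k \<le> guess_count Y s" "s \<le> t" for k s t Y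
      using that(1) guess_count_mono[OF that(2)] by (rule order_trans)
  qed (rule dec det)+
  then show False
    using guess_count_unbounded[OF assms(2)] by blast
qed

end

end

section \<open>Limit guesses and 2-randomness\<close>

text \<open>A level \<open>m\<close> at which only a set of small measure is still missing from the open set
  \<open>\<Union>s. {Y. R j s Y}\<close> can be found with the help of the jump. The missing parts form
  a test, so for a suitable bound on their measures a 2-random set lies in none of them.\<close>

lemma two_random_settled:
  assumes random: "two_random X"
    and dec: "decidable_in {} 3 (\<lambda>xs. R (xs ! 0) (xs ! 1) (set_decode (xs ! 2)))"
    and det: "\<And>j s. determined_below s (R j s)"
    and mono: "\<And>j s t Y. R j s Y \<Longrightarrow> s \<le> t \<Longrightarrow> R j t Y"
  shows "\<exists>m. recursive_in (turing_jump {}) 1 (\<lambda>xs. m (xs ! 0)) \<and> (\<forall>j s. R j s X \<longrightarrow> R j (m j) X)"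
proof -
  let ?J = "turing_jump {}"
  have R: "decidable_in A n (\<lambda>xs. R (f xs) (g xs) (set_decode (e xs)))"
    if "recursive_in A n f" "recursive_in A n g" "recursive_in A n e" for A n f g e
    using recursive_in_subst3[where g = "\<lambda>j s x. of_bool (R j s (set_decode x))",
        OF recursive_in_if_recursive[OF dec] that] .
  define count where "count j s = (\<Sum>x<2 ^ s. of_bool (R j s (set_decode x)) :: nat)" for j s
  have count: "recursive_in A n (\<lambda>xs. count (f xs) (g xs))"
    if "recursive_in A n f" "recursive_in A n g" for A n f g
    unfolding count_def
    by (intro recursive_in_sum R recursive_in_power that recursive_in_const recursive_in_proj
        recursive_in_tl[OF that(1)] recursive_in_tl[OF that(2)]) simp
  have prob: "cantor_prob (R j s) = count j s / 2 ^ s" for j s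
  proof -
    have "count j s = (\<Sum>Y\<in>Pow {..<s}. of_bool (R j s Y))"
      unfolding count_def by (rule sum.reindex_bij_betw[OF bij_betw_set_decode])
    also have "\<dots> = card (Pow {..<s} \<inter> {Y. R j s Y})"
      by simp
    also have "Pow {..<s} \<inter> {Y. R j s Y} = {Y. Y \<subseteq> {..<s} \<and> R j s Y}"
      by auto
    finally show ?thesis
      by (simp add: cantor_prob_eq_card[OF det])
  qed
  \<comment> \<open>\<open>late_iff\<close> with denominators cleared, so that the comparison is
    decidable in natural numbers. It says that more than \<open>(1 / 2) ^ (j + k + 1)\<close> of
    probability is gained between \<open>m\<close> and \<open>s\<close>; summed over
    \<open>j\<close>, these bounds stay below \<open>(1 / 2) ^ k\<close>.\<close>
  define late where "late j k m s \<longleftrightarrow> m \<le> s \<and>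
    count j m * (2 ^ s * 2 ^ (j + k + 1)) + 2 ^ s * 2 ^ m < count j s * (2 ^ m * 2 ^ (j + k + 1))" for j k m s
  have late_iff: "late j k m s \<longleftrightarrow> m \<le> s \<and> cantor_prob (R j m) + (1 / 2) ^ (j + k + 1) < cantor_prob (R j s)"
    for j k m s
  proof -
    define q :: real where "q = 2 ^ (j + k + 1)"
    have q: "q > 0" "(1 / 2) ^ (j + k + 1) = 1 / q"
      by (simp_all add: q_def power_divide)
    have "count j m * (2 ^ s * 2 ^ (j + k + 1)) + 2 ^ s * 2 ^ m < count j s * (2 ^ m * 2 ^ (j + k + 1))
      \<longleftrightarrow> real (count j m * (2 ^ s * 2 ^ (j + k + 1)) + 2 ^ s * 2 ^ m) < real (count j s * (2 ^ m * 2 ^ (j + k + 1)))"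
      by (simp only: of_nat_less_iff)
    also have "\<dots> \<longleftrightarrow> count j m * (2 ^ s * q) + 2 ^ s * 2 ^ m < count j s * (2 ^ m * q)"
      by (simp add: q_def)
    also have "\<dots> \<longleftrightarrow> count j m / 2 ^ m + 1 / q < count j s / 2 ^ s"
      using q(1) by (simp add: field_simps)
    finally show ?thesis
      unfolding late_def prob q(2) by blast
  qed
  have "decidable_in {} (Suc 3) (\<lambda>ys. late (tl ys ! 0) (tl ys ! 1) (tl ys ! 2) (ys ! 0))"
    unfolding late_def
    by (intro decidable_in_conj decidable_in_le decidable_in_less recursive_in_add recursive_in_mult
        recursive_in_power recursive_in_const count recursive_in_proj recursive_in_tl_nth(1)) simp_all
  then have ex_late: "decidable_in ?J 3 (\<lambda>xs. \<exists>s. late (xs ! 0) (xs ! 1) (xs ! 2) s)"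
    by (rule decidable_in_turing_jump_ex[where P = "\<lambda>s xs. late (xs ! 0) (xs ! 1) (xs ! 2) s"])
  define M where "M j k = (LEAST m. \<not> (\<exists>s. late j k m s))" for j k
  \<comment> \<open>The probabilities are bounded, and a stage that comes close enough to their
    supremum cannot be exceeded by the forbidden margin.\<close>
  have ex_M: "\<exists>m. \<not> (\<exists>s. late j k m s)" for j k
  proof -
    let ?S = "range (\<lambda>s. cantor_prob (R j s))"
    have bdd: "bdd_above ?S"
      by (rule bdd_aboveI2[where M = 1]) simp
    have "Sup ?S - (1 / 2) ^ (j + k + 1) < Sup ?S"
      by simp
    then obtain m where m: "Sup ?S - (1 / 2) ^ (j + k + 1) < cantor_prob (R j m)"
      using less_cSup_iff[of ?S "Sup ?S - (1 / 2) ^ (j + k + 1)"] bdd by blast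
    have "\<not> late j k m s" for s
      using m cSup_upper[OF rangeI[of "\<lambda>s. cantor_prob (R j s)" s] bdd] unfolding late_iff by linarith
    then show ?thesis by blast
  qed
  have M: "\<not> late j k (M j k) s" for j k s
    using LeastI_ex[OF ex_M[of j k]] unfolding M_def by blast
  have "decidable_in ?J (Suc 2) (\<lambda>ys. \<exists>s. late (tl ys ! 0) (tl ys ! 1) (ys ! 0) s)"
    by (rule recursive_in_subst3[where g = "\<lambda>j k m. of_bool (\<exists>s. late j k m s)", OF ex_late])
      (intro recursive_in_proj recursive_in_tl_nth(1); simp)+
  then have "recursive_in ?J 2 (\<lambda>xs. M (xs ! 0) (xs ! 1))"
    unfolding M_def by (intro recursive_in_Least decidable_in_not ex_M)
  then have rec_M: "recursive_in ?J n (\<lambda>xs. M (f xs) (g xs))"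
    if "recursive_in ?J n f" "recursive_in ?J n g" for n f g
    using recursive_in_subst2[where g = M] that by blast
  \<comment> \<open>The bound on \<open>j\<close> makes \<open>P\<close> decidable and the condition
    \<open>M j k \<le> s\<close> makes it depend on bits below \<open>s\<close> only. Both
    restrictions disappear as \<open>s\<close> grows.\<close>
  define P where "P k s Y \<longleftrightarrow> (\<exists>j<Suc s. M j k \<le> s \<and> R j s Y \<and> \<not> R j (M j k) Y)" for k s Y
  have "\<exists>k. \<forall>s. \<not> P k s X"
  proof (rule martin_loef_random_avoids)
    show "martin_loef_random ?J X"
      using random by (simp add: two_random_def)
    show "decidable_in ?J 3 (\<lambda>xs. P (xs ! 0) (xs ! 1) (set_decode (xs ! 2)))"
      unfolding P_def
      by (intro decidable_in_bex decidable_in_conj decidable_in_not decidable_in_le R rec_M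
          recursive_in_Suc recursive_in_proj recursive_in_tl_nth(1)) simp_all
    show "P k t Y" if "P k s Y" "s \<le> t" for k s t Y
    proof -
      from that(1) obtain j where "j < Suc s" "M j k \<le> s" "R j s Y" "\<not> R j (M j k) Y"
        unfolding P_def by blast
      with that(2) mono[of j s Y t] show ?thesis
        unfolding P_def by (intro exI[of _ j]) simp
    qed
    show "determined_below s (P k s)" for k s
    proof (rule determined_belowI)
      fix Y
      have "R j s (Y \<inter> {..<s}) \<longleftrightarrow> R j s Y" for j
        by (rule determined_belowD[OF det])
      moreover have "R j (M j k) (Y \<inter> {..<s}) \<longleftrightarrow> R j (M j k) Y" if "M j k \<le> s" for j
        by (rule determined_belowD[OF determined_below_mono[OF det that]])
      ultimately show "P k s (Y \<inter> {..<s}) \<longleftrightarrow> P k s Y"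
        unfolding P_def by blast
    qed
    show "cantor_prob (P k s) \<le> (1 / 2) ^ k" for k s
    proof -
      define C where "C j t = {y. R j t {i. y i}}" for j t
      have C: "C j t \<in> sets cantor_measure" for j t
        unfolding C_def by (rule cantor_measurable[OF det])
      define D where "D j = (if M j k \<le> s then C j s - C j (M j k) else {})" for j
      have "{y. P k s {i. y i}} = (\<Union>j<Suc s. D j)"
        unfolding P_def D_def C_def by (auto split: if_splits)
      then have "cantor_prob (P k s) \<le> (\<Sum>j<Suc s. measure cantor_measure (D j))"
        using C cantor.finite_measure_subadditive_finite[of "{..<Suc s}" D]
        by (auto simp: D_def image_subset_iff simp del: lessThan_Suc)
      also have "\<dots> \<le> (\<Sum>j<Suc s. (1 / 2) ^ (j + k + 1))"
      proof (rule sum_mono)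
        fix j
        show "measure cantor_measure (D j) \<le> (1 / 2) ^ (j + k + 1)"
        proof (cases "M j k \<le> s")
          case True
          then have "C j (M j k) \<subseteq> C j s"
            unfolding C_def using mono by blast
          then have "measure cantor_measure (D j) = cantor_prob (R j s) - cantor_prob (R j (M j k))"
            using True C unfolding D_def C_def by (simp add: cantor.finite_measure_Diff)
          with M[of j k s] True show ?thesis
            unfolding late_iff by linarith
        qed (simp add: D_def)
      qed
      also have "\<dots> = (1 / 2) ^ k * (1 - (1 / 2) ^ Suc s)" 
        by (induction s) (simp_all add: power_add field_simps)
      also have "\<dots> \<le> (1 / 2) ^ k * 1"
        by (rule mult_left_mono) simp_all
      finally show ?thesis by simp
    qed
  qed
  then obtain k where k: "\<And>s. \<not> P k s X"
    by blast
  have "R j (M j k) X" if "R j s X" for j s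
  proof -
    \<comment> \<open>A stage late enough for \<open>P k\<close> to inspect the index
      \<open>j\<close> and its level \<open>M j k\<close>.\<close>
    define t where "t = max s (max j (M j k))"
    have "R j t X"
      using mono[OF that, of t] by (simp add: t_def)
    with k[of t] show ?thesis
      unfolding P_def t_def by (auto simp: less_Suc_eq_le)
  qed
  moreover have "recursive_in ?J 1 (\<lambda>xs. M (xs ! 0) k)"
    by (intro rec_M recursive_in_proj recursive_in_const) simp
  ultimately show ?thesis
    by (intro exI[of _ "\<lambda>j. M j k"]) blast
qed

text \<open>\<open>R n u s Y\<close> says that the candidate \<open>u\<close> for the limit at \<open>n\<close> is refuted at stage \<open>s\<close>.\<close>

lemma not_two_random_if_limit_guessed:
  assumes dec: "decidable_in {} 4 (\<lambda>xs. R (xs ! 0) (xs ! 1) (xs ! 2) (set_decode (xs ! 3)))"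
    and det: "\<And>n u s. determined_below s (R n u s)"
    and self: "\<And>n u s Y. R n u s (Y - {n}) \<longleftrightarrow> R n u s Y"
    and mono: "\<And>n u s t Y. R n u s Y \<Longrightarrow> s \<le> t \<Longrightarrow> R n u t Y"
    and ex: "\<And>n. \<exists>u. \<forall>s. \<not> R n u s X"
    and sound: "\<And>n u. (\<And>s. \<not> R n u s X) \<Longrightarrow> n \<in> X \<longleftrightarrow> even u"
  shows "\<not> two_random X"
proof
  assume random: "two_random X"
  let ?J = "turing_jump {}"
  define R' where "R' j = R (fst (prod_decode j)) (snd (prod_decode j))" for j
  have R: "decidable_in A n (\<lambda>xs. R (f1 xs) (f2 xs) (f3 xs) (set_decode (f4 xs)))"
    if "recursive_in A n f1" "recursive_in A n f2" "recursive_in A n f3" "recursive_in A n f4" for A n f1 f2 f3 f4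
    using recursive_in_subst4[where g = "\<lambda>n u s x. of_bool (R n u s (set_decode x))",
        OF recursive_in_if_recursive[OF dec] that] .
  have "\<exists>m. recursive_in ?J 1 (\<lambda>xs. m (xs ! 0)) \<and> (\<forall>j s. R' j s X \<longrightarrow> R' j (m j) X)"
  proof (rule two_random_settled[OF random])
    show "decidable_in {} 3 (\<lambda>xs. R' (xs ! 0) (xs ! 1) (set_decode (xs ! 2)))"
      unfolding R'_def by (intro R recursive_in_prod_decode recursive_in_proj) simp_all
    show "determined_below s (R' j s)" for j s
      unfolding R'_def by (rule det)
    show "R' j t Y" if "R' j s Y" "s \<le> t" for j s t Y
      using that unfolding R'_def by (rule mono)
  qed
  then obtain m' where m': "recursive_in ?J 1 (\<lambda>xs. m' (xs ! 0))"
    and settled': "\<And>j s. R' j s X \<Longrightarrow> R' j (m' j) X"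
    by blast
  define m where "m n u = m' (prod_encode (n, u))" for n u
  have m: "recursive_in ?J n (\<lambda>xs. m (f xs) (g xs))"
    if "recursive_in ?J n f" "recursive_in ?J n g" for n f g
    unfolding m_def
    by (rule recursive_in_subst1[where g = m', OF m']) (intro recursive_in_prod_encode that)
  \<comment> \<open>For \<open>X\<close>, a candidate that survives stage \<open>m n u\<close> is
    never refuted, so finitely many bits of \<open>X\<close> now certify it.\<close>
  have settled: "R n u (m n u) X" if "R n u s X" for n u s
    using settled'[of "prod_encode (n, u)" s] that by (simp add: R'_def m_def)
  \<comment> \<open>The search at stage \<open>s\<close> stops for lack of stages
    (\<open>s \<le> u\<close>), at a candidate whose level is not yet visible
    (\<open>s < m n u\<close>), or at a surviving candidate. Only the last case yields a guess, the
    parity of \<open>u\<close>. Since an unready candidate is never skipped, a guess once made is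
    final.\<close>
  define Q where "Q s n Y u \<longleftrightarrow> s \<le> u \<or> s < m n u \<or> \<not> R n u (m n u) Y" for s n Y u
  define h where "h s n Y = (if (LEAST u. Q s n Y u) < s \<and> m n (LEAST u. Q s n Y u) \<le> s
    then Suc (of_bool (even (LEAST u. Q s n Y u))) else 0)" for s n Y
  have Q_iff: "Q s n Y u \<longleftrightarrow> Q s n Z u" if "\<And>u. m n u \<le> s \<Longrightarrow> R n u (m n u) Y \<longleftrightarrow> R n u (m n u) Z" for s n Y Z u
    using that[of u] unfolding Q_def by auto
  show False
  proof (rule notE[OF not_martin_loef_random_if_guessed[of h]])
    show "martin_loef_random ?J X"
      using random by (simp add: two_random_def)
    show "h s n (Y \<inter> {..<s}) = h s n Y" for s n Y
    proof -
      have "Q s n (Y \<inter> {..<s}) = Q s n Y"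
        by (rule ext, rule Q_iff, rule determined_belowD[OF determined_below_mono[OF det]])
      then show ?thesis unfolding h_def by simp
    qed
    show "h s n (Y - {n}) = h s n Y" for s n Y
    proof -
      have "Q s n (Y - {n}) = Q s n Y"
        by (rule ext, rule Q_iff, rule self)
      then show ?thesis unfolding h_def by simp
    qed
    have h_eq: "h s n Y = Suc (of_bool (even u))"
      if "u < s" "\<And>v. v \<le> u \<Longrightarrow> m n v \<le> s" "\<not> R n u (m n u) Y" "\<And>v. v < u \<Longrightarrow> R n v (m n v) Y"
      for s n Y u
    proof -
      have "(LEAST u. Q s n Y u) = u"
      proof (rule Least_equality)
        show "Q s n Y u" using that(3) by (simp add: Q_def)
        show "u \<le> v" if "Q s n Y v" for v
        proof (rule ccontr)
          assume "\<not> u \<le> v"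
          then show False
            using \<open>Q s n Y v\<close> \<open>u < s\<close> \<open>\<And>v. v \<le> u \<Longrightarrow> m n v \<le> s\<close>[of v] \<open>\<And>v. v < u \<Longrightarrow> R n v (m n v) Y\<close>[of v]
            by (simp add: Q_def)
        qed
      qed
      with that(1,2) show ?thesis by (simp add: h_def)
    qed
    show "h t n Y = h s n Y" if "h s n Y \<noteq> 0" "s \<le> t" for s t n Y
    proof -
      define u where "u = (LEAST u. Q s n Y u)"
      have u: "u < s" "m n u \<le> s"
        using that(1) unfolding h_def u_def by (auto split: if_splits)
      have "Q s n Y u"
        unfolding u_def by (rule LeastI[of _ s]) (simp add: Q_def)
      with u have notR: "\<not> R n u (m n u) Y"
        unfolding Q_def by simp
      have "m n v \<le> s \<and> R n v (m n v) Y" if "v < u" for v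
        using not_less_Least[OF that[unfolded u_def]] unfolding Q_def by auto
      then have least: "\<And>v. v < u \<Longrightarrow> R n v (m n v) Y" "\<And>v. v \<le> u \<Longrightarrow> m n v \<le> s"
        using u(2) by (auto simp: le_less)
      have "h t n Y = Suc (of_bool (even u))"
        using u(1) least notR that(2) by (intro h_eq) (auto intro: order_trans)
      moreover have "h s n Y = Suc (of_bool (even u))"
        using u(1) least notR by (intro h_eq) auto
      ultimately show ?thesis by simp
    qed
    show "\<exists>s. h s n X = Suc (of_bool (n \<in> X))" for n
    proof -
      from ex[of n] have ex': "\<exists>u. \<not> R n u (m n u) X"
        by blast
      define u where "u = (LEAST u. \<not> R n u (m n u) X)"
      have notR: "\<not> R n u (m n u) X"
        unfolding u_def by (rule LeastI_ex[OF ex'])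
      then have "n \<in> X \<longleftrightarrow> even u"
        using settled by (intro sound) blast
      moreover have "h (max (Suc u) (Max (m n ` {..u}))) n X = Suc (of_bool (even u))"
      proof (rule h_eq)
        show "m n v \<le> max (Suc u) (Max (m n ` {..u}))" if "v \<le> u" for v
          using that by (intro max.coboundedI2 Max_ge) auto
        show "R n v (m n v) X" if "v < u" for v
          using not_less_Least[OF that[unfolded u_def]] by blast
      qed (use notR in simp_all)
      ultimately show ?thesis by auto
    qed
    show "recursive_in ?J 3 (\<lambda>xs. h (xs ! 0) (xs ! 1) (set_decode (xs ! 2)))"
    proof -
      define l where "l s n x = (LEAST u. Q s n (set_decode x) u)" for s n x
      have exQ: "\<exists>u. Q s n Y u" for s n Y
        unfolding Q_def by blast
      have "decidable_in ?J (Suc 3) (\<lambda>ys. Q (tl ys ! 0) (tl ys ! 1) (set_decode (tl ys ! 2)) (ys ! 0))"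
        unfolding Q_def
        by (intro decidable_in_disj decidable_in_not decidable_in_le decidable_in_less R m
            recursive_in_proj recursive_in_tl_nth(1)) simp_all
      then have "recursive_in ?J 3 (\<lambda>xs. l (xs ! 0) (xs ! 1) (xs ! 2))"
        unfolding l_def by (intro recursive_in_Least exQ)
      then have "recursive_in ?J 3 (\<lambda>xs. if l (xs ! 0) (xs ! 1) (xs ! 2) < xs ! 0 \<and>
          m (xs ! 1) (l (xs ! 0) (xs ! 1) (xs ! 2)) \<le> xs ! 0
          then Suc (of_bool (\<not> odd (l (xs ! 0) (xs ! 1) (xs ! 2)))) else 0)"
        by (intro recursive_in_if decidable_in_conj decidable_in_less decidable_in_le m
            recursive_in_Suc decidable_in_not decidable_in_odd recursive_in_const recursive_in_proj) simp_all
      then show ?thesis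
        by (simp only: h_def l_def not_not)
    qed
  qed
qed

section \<open>The coding operators\<close>

lemma factorial_interval_unique:
  assumes "x \<in> factorial_interval m" "x \<in> factorial_interval n"
  shows "m = n"
proof -
  have "\<not> m < n" if "x \<in> factorial_interval m" "x \<in> factorial_interval n" for m n
  proof
    assume "m < n"
    then have "(fact (m + 1) :: nat) \<le> fact n"
      by (intro fact_mono_nat) simp
    with that show False
      unfolding factorial_interval_def by simp
  qed
  with assms show ?thesis
    by (meson linorder_neqE_nat)
qed

lemma mem_\<I>_iff: "x \<in> factorial_interval n \<Longrightarrow> x \<in> \<I> A \<longleftrightarrow> n \<in> A"
  unfolding \<I>_def using factorial_interval_unique by blast

lemma decidable_in_\<I>:
  "decidable_in A 3 (\<lambda>xs. xs ! 0 \<in> \<I> (set_decode (xs ! 2) - {xs ! 1}))"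
proof -
  \<comment> \<open>The search for the interval is bounded because
    \<open>n \<le> fact n \<le> x\<close> for every \<open>x\<close> in interval
    \<open>n\<close>.\<close>
  have eq: "x \<in> \<I> S \<longleftrightarrow> (\<exists>n<Suc x. n \<in> S \<and> fact n \<le> x \<and> x < fact (Suc n))" for x S
    unfolding \<I>_def factorial_interval_def
    using fact_ge_self order_trans by (fastforce simp: less_Suc_eq_le simp del: fact_Suc)
  show ?thesis
    unfolding eq Diff_iff singleton_iff
    by (intro decidable_in_bex decidable_in_conj decidable_in_not decidable_in_eq decidable_in_set_decode
        decidable_in_le decidable_in_less recursive_in_fact recursive_in_Suc recursive_in_proj
        recursive_in_tl_nth(1)) simp_all
qed

text \<open>An element of interval \<open>n\<close> is at least \<open>n\<close>. Oracle queries
  below \<open>s\<close> about \<open>\<I> Y\<close> therefore ask only for bits of \<open>Y\<close>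
  below \<open>s\<close>.\<close>

lemma \<I>_local:
  assumes "Y \<inter> {..<s} = Z \<inter> {..<s}" shows "\<I> Y \<inter> {..<s} = \<I> Z \<inter> {..<s}"
proof -
  have "x \<in> \<I> Y \<longleftrightarrow> x \<in> \<I> Z" if "x < s" for x
  proof -
    have "n \<in> Y \<longleftrightarrow> n \<in> Z" if "x \<in> factorial_interval n" for n
    proof -
      have "n \<le> x"
        using that fact_ge_self[of n] unfolding factorial_interval_def by simp
      then have "n \<in> {..<s}"
        using \<open>x < s\<close> by simp
      with assms show ?thesis by blast
    qed
    then show ?thesis
      unfolding \<I>_def by blast
  qed
  then show ?thesis by blast
qed

text \<open>Interval \<open>n\<close> has \<open>n * fact n\<close> of the
  \<open>(n + 1) * fact n\<close> elements below its right end. If fewer than a quarter of the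
  latter are errors, then by \<open>n + 1 \<le> 2 * n\<close> fewer than half of the interval are.
  This takes \<open>n \<ge> 1\<close>; interval 0 is empty.\<close>

lemma coarse_description_majority:
  assumes "coarse_description D (\<I> A)"
  shows "\<exists>N. \<forall>n\<ge>N. fact (Suc n) - fact n <
    2 * card {x \<in> factorial_interval n. x \<in> D \<longleftrightarrow> n \<in> A}"
proof -
  let ?E = "sym_diff D (\<I> A)"
  have "(\<lambda>n. partial_density n ?E) \<longlonglongrightarrow> 0"
    using assms unfolding coarse_description_def has_density_def .
  then have "\<forall>\<^sub>F n in sequentially. partial_density n ?E < 1 / 4"
    by (rule order_tendstoD) simp
  then obtain N where N: "\<And>n. N \<le> n \<Longrightarrow> partial_density n ?E < 1 / 4"
    unfolding eventually_sequentially by blast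
  have "fact (Suc n) - fact n < 2 * card {x \<in> factorial_interval n. x \<in> D \<longleftrightarrow> n \<in> A}"
    if n: "max 1 N \<le> n" for n
  proof -
    let ?I = "factorial_interval n"
    let ?F = "fact n :: nat"
    have fact: "fact (Suc n) = Suc n * ?F"
      by simp
    have card_I: "card ?I = n * ?F"
      by (simp add: factorial_interval_def)
    have "N \<le> fact (Suc n)"
      using fact_ge_self[of "Suc n"] n by linarith
    then have "partial_density (fact (Suc n)) ?E < 1 / 4"
      by (rule N)
    then have "real (card (?E \<inter> {0..<fact (Suc n)})) < 1 / 4 * real (fact (Suc n))"
      unfolding partial_density_def by (subst (asm) pos_divide_less_eq) (simp_all del: fact_Suc)
    then have "real (4 * card (?E \<inter> {0..<fact (Suc n)})) < real (Suc n * ?F)"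
      unfolding fact by (simp del: of_nat_Suc)
    then have "4 * card (?E \<inter> {0..<fact (Suc n)}) < Suc n * ?F"
      by (simp only: of_nat_less_iff)
    also have "\<dots> \<le> 2 * (n * ?F)"
      using n by simp
    finally have "2 * card (?E \<inter> {0..<fact (Suc n)}) < n * ?F"
      by simp
    moreover have "card (?I - {x \<in> ?I. x \<in> D \<longleftrightarrow> n \<in> A}) \<le> card (?E \<inter> {0..<fact (Suc n)})"
    proof (rule card_mono)
      show "?I - {x \<in> ?I. x \<in> D \<longleftrightarrow> n \<in> A} \<subseteq> ?E \<inter> {0..<fact (Suc n)}"
        using mem_\<I>_iff[of _ n A] by (auto simp: factorial_interval_def simp del: fact_Suc)
    qed simp
    moreover have "card (?I - {x \<in> ?I. x \<in> D \<longleftrightarrow> n \<in> A})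
        = card ?I - card {x \<in> ?I. x \<in> D \<longleftrightarrow> n \<in> A}"
      by (rule card_Diff_subset) (auto simp: factorial_interval_def)
    ultimately show ?thesis
      unfolding card_I fact by simp
  qed
  then show ?thesis by blast
qed

lemma coarse_description_refl: "coarse_description A A"
  by (simp add: coarse_description_def has_density_def partial_density_def)

lemma coarse_description_\<I>_remove: "coarse_description (\<I> (X - {n})) (\<I> X)"
proof -
  let ?E = "sym_diff (\<I> (X - {n})) (\<I> X)"
  let ?c = "card (factorial_interval n)"
  have "?E \<subseteq> factorial_interval n"
    unfolding \<I>_def by blast
  then have "card (?E \<inter> {0..<m}) \<le> ?c" for m
    by (intro card_mono) (auto simp: factorial_interval_def)
  then have upper: "partial_density m ?E \<le> ?c / m" for m
    unfolding partial_density_def by (simp add: divide_right_mono)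
  have "(\<lambda>m. partial_density m ?E) \<longlonglongrightarrow> 0"
  proof (rule tendsto_sandwich)
    show "\<forall>\<^sub>F m in sequentially. 0 \<le> partial_density m ?E"
      unfolding partial_density_def by simp
    show "\<forall>\<^sub>F m in sequentially. partial_density m ?E \<le> ?c / m"
      using upper by (rule always_eventually[OF allI])
    show "(\<lambda>m. ?c / real m) \<longlonglongrightarrow> 0"
      by (rule lim_const_over_n)
  qed (rule tendsto_const)
  then show ?thesis
    unfolding coarse_description_def has_density_def .
qed

lemma
  assumes "computable_pairing pair"
  shows pair_inj: "pair n i = pair m j \<longleftrightarrow> n = m \<and> i = j"
    and pair_surj: "\<exists>n i. pair n i = k"
    and recursive_in_pair: "recursive_in A l f \<Longrightarrow> recursive_in A l g \<Longrightarrow> recursive_in A l (\<lambda>xs. pair (f xs) (g xs))"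
proof -
  from assms have bij: "bij (\<lambda>(n, i). pair n i)"
    and "\<exists>p. \<forall>n i. eval {} p [n, i] = Some (pair n i)"
    unfolding computable_pairing_def by simp_all
  then obtain p where p: "\<And>n i. eval {} p [n, i] = Some (pair n i)"
    by blast
  show "pair n i = pair m j \<longleftrightarrow> n = m \<and> i = j"
    using inj_eq[OF bij_is_inj[OF bij], of "(n, i)" "(m, j)"] by simp
  show "\<exists>n i. pair n i = k"
    using surjD[OF bij_is_surj[OF bij], of k] by (auto simp: eq_commute)
  have "eval {} p xs = Some (pair (xs ! 0) (xs ! 1))" if "length xs = 2" for xs
  proof -
    from that obtain n i where "xs = [n, i]"
      by (auto simp: length_Suc_conv numeral_2_eq_2)
    then show ?thesis by (simp add: p)
  qed
  then have "recursive_in {} 2 (\<lambda>xs. pair (xs ! 0) (xs ! 1))"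
    unfolding recursive_in_def by blast
  from recursive_in_subst2[where g = pair, OF recursive_in_if_recursive[OF this]]
  show "recursive_in A l f \<Longrightarrow> recursive_in A l g \<Longrightarrow> recursive_in A l (\<lambda>xs. pair (f xs) (g xs))" .
qed

lemma mem_\<H>_iff:
  assumes "computable_pairing pair" shows "pair n i \<in> \<H> pair A \<longleftrightarrow> n \<in> A"
  by (auto simp: \<H>_def pair_inj[OF assms])

text \<open>As a bounded sum of truth values, the majority count falls under the closure rules for
  recursive functions.\<close>

lemma card_factorial_interval_filter:
  "card {x \<in> factorial_interval n. P x} = (\<Sum>x<fact (Suc n). of_bool (fact n \<le> x \<and> P x))"
proof -
  have "{x \<in> factorial_interval n. P x} = {..<fact (Suc n)} \<inter> {x. fact n \<le> x \<and> P x}"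
    by (auto simp: factorial_interval_def)
  then show ?thesis by simp
qed

section \<open>The nonuniform reduction\<close>

lemma \<E>_nc_reducible_\<I>:
  assumes pair: "computable_pairing pair"
  shows "\<E> pair X \<le>\<^sub>n\<^sub>c \<I> X"
  unfolding nc_reducible_def
proof (intro allI impI)
  fix D assume "coarse_description D (\<I> X)"
  then obtain N where
    N: "\<And>n. N \<le> n \<Longrightarrow> fact (Suc n) - fact n < 2 * card {x \<in> factorial_interval n. x \<in> D \<longleftrightarrow> n \<in> X}"
    using coarse_description_majority by blast
  define maj where "maj n \<longleftrightarrow> fact (Suc n) - fact n < 2 * card {x \<in> factorial_interval n. x \<in> D}" for n
  have maj: "maj n \<longleftrightarrow> n \<in> X" if "N \<le> n" for n
  proof (cases "n \<in> X")
    case True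
    then show ?thesis using N[OF that] by (simp add: maj_def)
  next
    case False
    let ?I = "factorial_interval n"
    have "card ({x \<in> ?I. x \<in> D} \<union> {x \<in> ?I. x \<notin> D}) = card {x \<in> ?I. x \<in> D} + card {x \<in> ?I. x \<notin> D}"
      by (rule card_Un_disjoint) (auto simp: factorial_interval_def)
    moreover have "{x \<in> ?I. x \<in> D} \<union> {x \<in> ?I. x \<notin> D} = ?I"
      by blast
    moreover have "card ?I = fact (Suc n) - fact n"
      by (simp add: factorial_interval_def)
    ultimately show ?thesis
      using N[OF that] False by (simp add: maj_def del: fact_Suc)
  qed
  define c where "c = set_encode (X \<inter> {..<N})"
  have X_iff: "n \<in> X \<longleftrightarrow> (if n < N then n \<in> set_decode c else maj n)" for n
    using maj[of n] by (auto simp: c_def)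
  have X: "decidable_in D l (\<lambda>xs. f xs \<in> X)" if f: "recursive_in D l f" for l f
  proof -
    have maj: "decidable_in D l (\<lambda>xs. maj (f xs))"
      unfolding maj_def card_factorial_interval_filter
      by (intro decidable_in_less decidable_in_conj decidable_in_le decidable_in_oracle recursive_in_sum
          recursive_in_mult recursive_in_diff recursive_in_fact recursive_in_Suc recursive_in_const f
          recursive_in_tl[OF f] recursive_in_proj) simp_all
    have "decidable_in D l (\<lambda>xs. f xs < N \<and> f xs \<in> set_decode c \<or> \<not> f xs < N \<and> maj (f xs))"
      by (intro decidable_in_disj decidable_in_conj decidable_in_less decidable_in_not
          decidable_in_set_decode maj f recursive_in_const)
    then show ?thesis
      unfolding X_iff[of "f _"] by (simp add: if_bool_eq_disj)
  qed
  define idx where "idx x = (LEAST k. x < fact (Suc k))" for x :: nat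
  have ex_idx: "\<exists>k. x < fact (Suc k)" for x :: nat
    using fact_ge_self[of "Suc x"] by (intro exI[of _ x]) linarith
  have idx: "recursive_in D 1 (\<lambda>xs. idx (xs ! 0))"
    unfolding idx_def
    by (intro recursive_in_Least decidable_in_less recursive_in_fact recursive_in_Suc recursive_in_proj
        recursive_in_tl_nth(1) ex_idx) simp_all
  \<comment> \<open>The pairing is inverted by search: its surjectivity guarantees a bound for both
    coordinates, after which the row is found with the other coordinate bounded.\<close>
  define bnd where "bnd k = (LEAST b. \<exists>n<Suc b. \<exists>i<Suc b. pair n i = k)" for k
  have ex_bnd: "\<exists>b. \<exists>n<Suc b. \<exists>i<Suc b. pair n i = k" for k
  proof -
    obtain n i where "pair n i = k"
      using pair_surj[OF pair] by blast
    then show ?thesis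
      by (intro exI[of _ "max n i"] exI[of _ n] exI[of _ i] conjI) simp_all
  qed
  have bnd: "recursive_in D l (\<lambda>xs. bnd (f xs))" if f: "recursive_in D l f" for l f
  proof -
    have "recursive_in D 1 (\<lambda>xs. bnd (xs ! 0))"
      unfolding bnd_def
      by (intro recursive_in_Least decidable_in_bex decidable_in_eq recursive_in_pair[OF pair]
          recursive_in_Suc recursive_in_proj recursive_in_tl_nth ex_bnd) simp_all
    then show ?thesis
      using recursive_in_subst1[where g = bnd] f by blast
  qed
  define row where "row k = (LEAST n. \<exists>i<Suc (bnd k). pair n i = k)" for k
  have row_eq: "\<exists>i. pair (row k) i = k" and ex_row: "\<exists>n. \<exists>i<Suc (bnd k). pair n i = k" for k
  proof -
    show ex: "\<exists>n. \<exists>i<Suc (bnd k). pair n i = k"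
      using LeastI_ex[OF ex_bnd[of k]] unfolding bnd_def by blast
    show "\<exists>i. pair (row k) i = k"
      using LeastI_ex[OF ex] unfolding row_def by blast
  qed
  have row: "recursive_in D 1 (\<lambda>xs. row (xs ! 0))"
    unfolding row_def
    by (intro recursive_in_Least decidable_in_bex decidable_in_eq recursive_in_pair[OF pair] bnd
        recursive_in_Suc recursive_in_proj recursive_in_tl_nth ex_row) simp_all
  \<comment> \<open>The number 0 lies in no factorial interval, since factorials are
    positive.\<close>
  have "decidable_in D 1 (\<lambda>xs. 0 < xs ! 0 \<and> row (idx (xs ! 0)) \<in> X)"
    by (intro decidable_in_conj decidable_in_less X recursive_in_const recursive_in_proj
        recursive_in_subst1[where g = row, OF row idx]) simp_all
  then obtain p where p: "\<And>xs. length xs = 1 \<Longrightarrow>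
      eval D p xs = Some (of_bool (0 < xs ! 0 \<and> row (idx (xs ! 0)) \<in> X))"
    unfolding recursive_in_def by blast
  have "x \<in> \<E> pair X \<longleftrightarrow> 0 < x \<and> row (idx x) \<in> X" for x
  proof (cases "x = 0")
    case True
    then show ?thesis
      by (auto simp: \<E>_def \<I>_def factorial_interval_def)
  next
    case False
    have "x < fact (Suc (idx x))"
      unfolding idx_def by (rule LeastI_ex[OF ex_idx])
    moreover have "fact (idx x) \<le> x"
    proof (cases "idx x")
      case (Suc k)
      then show ?thesis
        using not_less_Least[of k "\<lambda>k. x < fact (Suc k)"] unfolding idx_def[symmetric] by simp
    qed (use False in simp)
    ultimately have "x \<in> factorial_interval (idx x)"
      by (simp add: factorial_interval_def)
    then have "x \<in> \<E> pair X \<longleftrightarrow> idx x \<in> \<H> pair X"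
      unfolding \<E>_def by (rule mem_\<I>_iff)
    also have "\<dots> \<longleftrightarrow> row (idx x) \<in> X"
      using row_eq[of "idx x"] mem_\<H>_iff[OF pair] by metis
    finally show ?thesis
      using False by simp
  qed
  then have "computes_set p D (\<E> pair X)"
    unfolding computes_set_def by (simp add: p)
  then show "\<exists>p Z. computes_set p D Z \<and> coarse_description Z (\<E> pair X)"
    using coarse_description_refl by blast
qed

text \<open>That one value is the majority on all late intervals of a row cannot be refuted at a
  finite stage when computations may diverge. That the other value never has the majority can be:
  finitely many convergent computations refute it. Hence candidates are stated negatively, and on
  \<open>X\<close> the claims with the right parity and a large bound are exactly strong enough to
  survive.\<close>

lemma not_\<E>_uc_reducible_\<I>:
  assumes pair: "computable_pairing pair" and random: "two_random X"
  shows "\<not> \<E> pair X \<le>\<^sub>u\<^sub>c \<I> X"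
proof
  assume "\<E> pair X \<le>\<^sub>u\<^sub>c \<I> X"
  then obtain p where p: "\<And>D. coarse_description D (\<I> X) \<Longrightarrow>
      \<exists>Z. computes_set p D Z \<and> coarse_description Z (\<E> pair X)"
    unfolding uc_reducible_def by blast
  let ?val = "\<lambda>n u Y s x. eval_upto s (\<I> (Y - {n})) p [x] = Some (of_bool (odd u))"
  \<comment> \<open>The candidate \<open>u\<close> claims that from row position \<open>u div 2\<close> on, \<open>odd u\<close> is never the majority value.\<close>
  define R where "R n u s Y \<longleftrightarrow> (\<exists>i<s. u div 2 \<le> i \<and> fact (Suc (pair n i)) - fact (pair n i) <
      2 * card {x \<in> factorial_interval (pair n i). ?val n u Y s x})" for n u s Y
  have settled: "\<exists>N. \<forall>i\<ge>N. fact (Suc (pair n i)) - fact (pair n i) <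
    2 * card {x \<in> factorial_interval (pair n i). eval (\<I> (X - {n})) p [x] = Some (of_bool (n \<in> X))}" for n
  proof -
    obtain Z where Z: "computes_set p (\<I> (X - {n})) Z" "coarse_description Z (\<I> (\<H> pair X))"
      using p[OF coarse_description_\<I>_remove] unfolding \<E>_def by blast
    from coarse_description_majority[OF Z(2)] obtain N where
      N: "\<And>k. N \<le> k \<Longrightarrow> fact (Suc k) - fact k < 2 * card {x \<in> factorial_interval k. x \<in> Z \<longleftrightarrow> k \<in> \<H> pair X}"
      by blast
    \<comment> \<open>Late intervals are reached along the row of \<open>n\<close>: by injectivity
      only finitely many \<open>i\<close> give \<open>pair n i < N\<close>.\<close>
    have "inj (pair n)"
      by (rule injI) (simp add: pair_inj[OF pair])
    then have "finite (pair n -` {..<N})"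
      by (intro finite_vimageI) simp_all
    then have "\<exists>b. \<forall>i\<in>pair n -` {..<N}. i < b"
      by (simp only: finite_nat_set_iff_bounded)
    then obtain b where b: "\<And>i. i \<in> pair n -` {..<N} \<Longrightarrow> i < b"
      by blast
    have agree: "eval (\<I> (X - {n})) p [x] = Some (of_bool (n \<in> X)) \<longleftrightarrow> (x \<in> Z \<longleftrightarrow> n \<in> X)" for x
      using Z(1) unfolding computes_set_def by auto
    have "N \<le> pair n i" if "b \<le> i" for i
    proof (rule ccontr)
      assume "\<not> N \<le> pair n i"
      then have "i \<in> pair n -` {..<N}"
        by simp
      with b that show False
        by fastforce
    qed
    then have "fact (Suc (pair n i)) - fact (pair n i) <
        2 * card {x \<in> factorial_interval (pair n i). x \<in> Z \<longleftrightarrow> n \<in> X}" if "b \<le> i" for i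
      using N[of "pair n i"] that unfolding mem_\<H>_iff[OF pair] by blast
    then show ?thesis
      unfolding agree by blast
  qed
  have "\<not> two_random X"
  proof (rule not_two_random_if_limit_guessed)
    show "determined_below s (R n u s)" for n u s
    proof (rule determined_belowI)
      fix Y
      have "(Y \<inter> {..<s} - {n}) \<inter> {..<s} = (Y - {n}) \<inter> {..<s}"
        by blast
      then have "eval_upto s (\<I> (Y \<inter> {..<s} - {n})) p = eval_upto s (\<I> (Y - {n})) p"
        by (intro eval_upto_local \<I>_local)
      then show "R n u s (Y \<inter> {..<s}) \<longleftrightarrow> R n u s Y"
        unfolding R_def by simp
    qed
    show "R n u s (Y - {n}) \<longleftrightarrow> R n u s Y" for n u s Y
      unfolding R_def by simp
    show "R n u t Y" if R: "R n u s Y" and "s \<le> t" for n u s t Y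
    proof -
      from R obtain i where i: "i < s" "u div 2 \<le> i" and
        "fact (Suc (pair n i)) - fact (pair n i) < 2 * card {x \<in> factorial_interval (pair n i). ?val n u Y s x}"
        unfolding R_def by blast
      note this(3)
      also have "card {x \<in> factorial_interval (pair n i). ?val n u Y s x}
          \<le> card {x \<in> factorial_interval (pair n i). ?val n u Y t x}"
        using eval_upto_mono[OF _ \<open>s \<le> t\<close>] by (intro card_mono) (auto simp: factorial_interval_def)
      finally show ?thesis
        using i \<open>s \<le> t\<close> unfolding R_def by (intro exI[of _ i]) simp
    qed
    show "n \<in> X \<longleftrightarrow> even u" if notR: "\<And>s. \<not> R n u s X" for n u
    proof (rule ccontr)
      assume "(n \<in> X) \<noteq> even u"
      then have u: "odd u \<longleftrightarrow> n \<in> X"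
        by blast
      obtain N where N: "\<And>i. N \<le> i \<Longrightarrow> fact (Suc (pair n i)) - fact (pair n i) <
        2 * card {x \<in> factorial_interval (pair n i). eval (\<I> (X - {n})) p [x] = Some (of_bool (n \<in> X))}"
        using settled by blast
      define i where "i = max N (u div 2)"
      define S where "S = {x \<in> factorial_interval (pair n i). eval (\<I> (X - {n})) p [x] = Some (of_bool (n \<in> X))}"
      have "finite S"
        unfolding S_def factorial_interval_def by simp
      \<comment> \<open>Finitely many convergent computations make up the majority, so one stage
        sees all of them.\<close>
      then have "\<forall>\<^sub>F s in sequentially. \<forall>x\<in>S. ?val n u X s x"
        by (rule eventually_ball_finite) (auto simp: S_def u intro: eventually_eval_upto)
      with eventually_gt_at_top[of i] have "\<forall>\<^sub>F s in sequentially. i < s \<and> (\<forall>x\<in>S. ?val n u X s x)"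
        by (rule eventually_conj)
      then obtain s where s: "i < s" "\<And>x. x \<in> S \<Longrightarrow> ?val n u X s x"
        using eventually_happens'[OF sequentially_bot] by blast
      have "fact (Suc (pair n i)) - fact (pair n i) < 2 * card S"
        using N[of i] unfolding S_def i_def by simp
      also have "card S \<le> card {x \<in> factorial_interval (pair n i). ?val n u X s x}"
        using s(2) by (intro card_mono) (auto simp: S_def factorial_interval_def)
      finally have "R n u s X"
        unfolding R_def using s(1) by (intro exI[of _ i]) (simp add: i_def)
      with notR show False by blast
    qed
    show "\<exists>u. \<forall>s. \<not> R n u s X" for n
    proof -
      obtain N where N: "\<And>i. N \<le> i \<Longrightarrow> fact (Suc (pair n i)) - fact (pair n i) <
        2 * card {x \<in> factorial_interval (pair n i). eval (\<I> (X - {n})) p [x] = Some (of_bool (n \<in> X))}"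
        using settled by blast
      \<comment> \<open>An even \<open>u\<close> stands for \<open>n \<in> X\<close>. Then
        \<open>odd u\<close> is the negation of the true bit, and it is the value that
        \<open>u\<close> claims to lose from position \<open>N\<close> on.\<close>
      define u where "u = 2 * N + of_bool (n \<notin> X)"
      have u: "u div 2 = N" "odd u \<longleftrightarrow> n \<notin> X"
        by (auto simp: u_def)
      have "\<not> R n u s X" for s
      proof
        assume "R n u s X"
        then obtain i where "N \<le> i" and R: "fact (Suc (pair n i)) - fact (pair n i) <
            2 * card {x \<in> factorial_interval (pair n i). ?val n u X s x}"
          unfolding R_def u(1) by blast
        let ?I = "factorial_interval (pair n i)"
        let ?S = "{x \<in> ?I. eval (\<I> (X - {n})) p [x] = Some (of_bool (n \<in> X))}"
        let ?T = "{x \<in> ?I. ?val n u X s x}"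
        have fin: "finite ?I"
          by (simp add: factorial_interval_def)
        \<comment> \<open>One input cannot have both values, and two disjoint strict majorities do
          not fit into one interval.\<close>
        have "?S \<inter> ?T = {}"
          using eval_if_eval_upto[of s "\<I> (X - {n})" p _ "of_bool (odd u)"] u(2) by auto
        then have "card ?S + card ?T = card (?S \<union> ?T)"
          using fin by (simp add: card_Un_disjoint)
        also have "\<dots> \<le> card ?I"
          using fin by (intro card_mono) auto
        finally show False
          using R N[OF \<open>N \<le> i\<close>] by (simp add: factorial_interval_def)
      qed
      then show ?thesis by blast
    qed
    show "decidable_in {} 4 (\<lambda>xs. R (xs ! 0) (xs ! 1) (xs ! 2) (set_decode (xs ! 3)))"
    proof -
      \<comment> \<open>The two additional variables are the bound \<open>x\<close> of the sum, in
        front, and the bound \<open>i\<close> of the quantifier.\<close>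
      have "recursive_in {} (Suc (Suc 4)) (\<lambda>ys. option_code (eval_upto (tl (tl ys) ! 2)
          ((\<lambda>n y. \<I> (set_decode y - {n})) (tl (tl ys) ! 0) (tl (tl ys) ! 3)) p (map (\<lambda>f. f ys) [\<lambda>ys. ys ! 0])))"
        by (rule recursive_in_eval_upto[OF decidable_in_\<I>])
          (auto intro!: recursive_in_tl_nth(2) recursive_in_proj)
      then have val: "decidable_in {} (Suc (Suc 4)) (\<lambda>ys. option_code (eval_upto (tl (tl ys) ! 2)
          (\<I> (set_decode (tl (tl ys) ! 3) - {tl (tl ys) ! 0})) p [ys ! 0]) = Suc (of_bool (odd (tl (tl ys) ! 1))))"
        by (intro decidable_in_eq recursive_in_Suc decidable_in_odd recursive_in_tl_nth(2)) simp_all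
      have "decidable_in {} 4 (\<lambda>xs. \<exists>i<xs ! 2. xs ! 1 div 2 \<le> i \<and>
        (fact (Suc (pair (xs ! 0) i)) :: nat) - fact (pair (xs ! 0) i) < 2 * (\<Sum>x<fact (Suc (pair (xs ! 0) i)).
          of_bool (fact (pair (xs ! 0) i) \<le> x \<and> option_code (eval_upto (xs ! 2)
            (\<I> (set_decode (xs ! 3) - {xs ! 0})) p [x]) = Suc (of_bool (odd (xs ! 1))))))"
        by (intro decidable_in_bex decidable_in_conj decidable_in_le decidable_in_less recursive_in_div
            recursive_in_diff recursive_in_mult recursive_in_sum recursive_in_fact recursive_in_Suc
            recursive_in_pair[OF pair] val recursive_in_const recursive_in_proj recursive_in_tl_nth) simp_all
      then show ?thesis
        unfolding R_def card_factorial_interval_filter by (simp only: option_code_simps)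
    qed
  qed
  with random show False by blast
qed

theorem corollary2p11:
  fixes pair :: "nat \<Rightarrow> nat \<Rightarrow> nat" and X :: "nat set"
  assumes "computable_pairing pair"
    and "two_random X"
  shows "\<E> pair X \<le>\<^sub>n\<^sub>c \<I> X \<and> \<not> \<E> pair X \<le>\<^sub>u\<^sub>c \<I> X"
  using \<E>_nc_reducible_\<I>[OF assms(1)] not_\<E>_uc_reducible_\<I>[OF assms] by blast

end
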